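(* Let $\Bbbk$ be a field and let $f$ be an irreducible polynomial in $\Bbbk[t]$ dividing $t^m-1$, for some $m\ge1$. Then, for any integer $i>0$, there exist a finite simplicial complex $L$ and an epimorphism $\chi\colon G_L\twoheadrightarrow\mathbb Z$ such that $H_i(T_L,\Bbbk\mathbb Z_\chi)$ has non-trivial $f$-primary part.
   Context: For a finite simplicial complex $L$ with vertex set $\mathsf V$ (simplices identified with their vertex sets, every $v\in\mathsf V$ a vertex of $L$), the toric complex is the subcomplex $T_L=\bigcup_{\sigma\in L}\{x: x_v=*\text{ for }v\notin\sigma\}$ of $(S^1)^{\mathsf V}$, where $S^1$ has one $0$-cell $*$ and one $1$-cell. Its fundamental group is the right-angled Artin group $G_L=\langle v\in\mathsf V\mid uv=vu\text{ if }\{u,v\}\text{ is an edge of }L\rangle$. $\Bbbk\mathbb Z=\Bbbk[t^{\pm1}]$, and $\Bbbk\mathbb Z_\chi$ is $\Bbbk\mathbb Z$ viewed as a $\Bbbk G_L$-module via the linear extension of $\chi$. Then $H_i(T_L,\Bbbk\mathbb Z_\chi)\cong H_i(T_L^\chi,\Bbbk)$ as $\Bbbk\mathbb Z$-modules, where $T_L^\chi\to T_L$ is the infinite cyclic cover with fundamental group $\ker\chi$ and $\mathbb Z$ acts by deck transformations. These are finitely generated modules over the PID $\Bbbk[t^{\pm1}]$; the $f$-primary part of such a module is its $f$-power torsion submodule. *)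

theory Defs
  imports
    "HOL-Analysis.Analysis"
    "HOL-Homology.Homology"
    "HOL-Algebra.Module"
    "HOL-Computational_Algebra.Polynomial"
begin

section \<open>Simplicial complexes and right-angled Artin groups\<close>

text \<open>The vertex set of \<open>L\<close> is \<open>\<Union>L\<close>. The empty simplex belongs to every complex.\<close>

definition finite_simplicial_complex :: "'v set set \<Rightarrow> bool" where
  "finite_simplicial_complex L \<longleftrightarrow>
     finite L \<and> (\<forall>\<sigma>\<in>L. finite \<sigma>) \<and> {} \<in> L \<and> (\<forall>\<sigma>\<in>L. \<forall>\<tau>. \<tau> \<subseteq> \<sigma> \<longrightarrow> \<tau> \<in> L)"

text \<open>Group words: \<open>(v, True)\<close> stands for the generator \<open>v\<close> and \<open>(v, False)\<close> for its inverse.\<close>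

type_synonym 'v word = "('v \<times> bool) list"

inductive raag_step :: "'v set set \<Rightarrow> 'v word \<Rightarrow> 'v word \<Rightarrow> bool" for L where
  cancel: "v \<in> \<Union>L \<Longrightarrow> raag_step L (x @ [(v, b), (v, \<not> b)] @ y) (x @ y)"
| commute: "{u, v} \<in> L \<Longrightarrow>
    raag_step L (x @ [(u, True), (v, True)] @ y) (x @ [(v, True), (u, True)] @ y)"

definition raag_class :: "'v set set \<Rightarrow> 'v word \<Rightarrow> 'v word set" where
  "raag_class L w = {w'. equivclp (raag_step L) w w'}"

definition raag :: "'v set set \<Rightarrow> 'v word set monoid" where
  "raag L = \<lparr>carrier = raag_class L ` lists (\<Union>L \<times> UNIV),
             monoid.mult = (\<lambda>A B. \<Union>a\<in>A. \<Union>b\<in>B. raag_class L (a @ b)),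
             one = raag_class L []\<rparr>"

definition raag_gen :: "'v set set \<Rightarrow> 'v \<Rightarrow> 'v word set" where
  "raag_gen L v = raag_class L [(v, True)]"


lemma raag_eq_append:
  assumes "equivclp (raag_step L) a a'"
  shows "equivclp (raag_step L) (x @ a @ y) (x @ a' @ y)"
proof -
  have step: "raag_step L (x @ a @ y) (x @ b @ y)" if "raag_step L a b" for a b
    using that
  proof cases
    case (cancel v p c q)
    then show ?thesis using raag_step.cancel[of v L "x @ p" c "q @ y"] by simp
  next
    case (commute u v p q)
    then show ?thesis using raag_step.commute[of u v L "x @ p" "q @ y"] by simp
  qed
  have "(symclp (raag_step L))\<^sup>*\<^sup>* a a'"
    using assms by (simp add: equivclp_def)
  then show ?thesis
    unfolding equivclp_def
  proof (induction rule: rtranclp_induct)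
    case (step b c)
    then have "symclp (raag_step L) (x @ b @ y) (x @ c @ y)"
      using \<open>\<And>a b. raag_step L a b \<Longrightarrow> raag_step L (x @ a @ y) (x @ b @ y)\<close>
      by (auto simp: symclp_def)
    with step.IH show ?case by (rule rtranclp.rtrancl_into_rtrancl)
  qed auto
qed

lemma raag_class_eq_iff: "raag_class L a = raag_class L b \<longleftrightarrow> equivclp (raag_step L) a b"
proof
  assume "raag_class L a = raag_class L b"
  then have "b \<in> raag_class L a" by (simp add: raag_class_def)
  then show "equivclp (raag_step L) a b" by (simp add: raag_class_def)
next
  assume ab: "equivclp (raag_step L) a b"
  have "equivclp (raag_step L) a w \<longleftrightarrow> equivclp (raag_step L) b w" for w
    using equivclp_trans[OF ab, of w] equivclp_trans[OF equivclp_sym[OF ab], of w] by blast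
  then show "raag_class L a = raag_class L b"
    by (simp add: raag_class_def)
qed

lemma raag_mult_class: "raag_class L a \<otimes>\<^bsub>raag L\<^esub> raag_class L b = raag_class L (a @ b)"
proof -
  have *: "raag_class L (a' @ b') = raag_class L (a @ b)"
    if "a' \<in> raag_class L a" "b' \<in> raag_class L b" for a' b'
  proof -
    have "equivclp (raag_step L) (a @ b) (a' @ b)" "equivclp (raag_step L) (a' @ b) (a' @ b')"
      using that raag_eq_append[of L a a' "[]" b] raag_eq_append[of L b b' a' "[]"]
      by (auto simp: raag_class_def)
    then show ?thesis
      unfolding raag_class_eq_iff by (rule equivclp_sym[OF equivclp_trans])
  qed
  have "a \<in> raag_class L a" "b \<in> raag_class L b"
    by (simp_all add: raag_class_def)
  then have "(\<Union>a'\<in>raag_class L a. \<Union>b'\<in>raag_class L b. raag_class L (a' @ b'))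
      = (\<Union>a'\<in>raag_class L a. \<Union>b'\<in>raag_class L b. raag_class L (a @ b))"
    by (intro SUP_cong refl *)
  also have "\<dots> = raag_class L (a @ b)"
    using \<open>a \<in> raag_class L a\<close> \<open>b \<in> raag_class L b\<close> by auto
  finally show ?thesis
    by (simp add: raag_def)
qed

lemma group_raag: "group (raag L)"
proof (rule groupI)
  fix x assume "x \<in> carrier (raag L)"
  then obtain w where w: "w \<in> lists (\<Union>L \<times> UNIV)" "x = raag_class L w"
    by (auto simp: raag_def)
  define inv_word where "inv_word = (\<lambda>w. rev (map (\<lambda>(v, b). (v, \<not> b)) w) :: 'a word)"
  have "inv_word w \<in> lists (\<Union>L \<times> UNIV) \<and> equivclp (raag_step L) (inv_word w @ w) []"
    using w(1)
  proof (induction w)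
    case (Cons l w)
    obtain v b where l: "l = (v, b)" by fastforce
    have "raag_step L (inv_word w @ [(v, \<not> b), (v, \<not> \<not> b)] @ w) (inv_word w @ w)"
      using Cons.hyps l by (intro raag_step.cancel) auto
    then have "equivclp (raag_step L) (inv_word (l # w) @ l # w) (inv_word w @ w)"
      by (intro r_into_equivclp) (simp add: inv_word_def l)
    with Cons l show ?case
      by (auto simp: inv_word_def intro: equivclp_trans)
  qed (simp add: inv_word_def)
  then have "raag_class L (inv_word w) \<in> carrier (raag L)"
      "raag_class L (inv_word w) \<otimes>\<^bsub>raag L\<^esub> x = raag_class L []"
    unfolding w(2) raag_mult_class raag_class_eq_iff by (auto simp: raag_def)
  moreover have "\<one>\<^bsub>raag L\<^esub> = raag_class L []"
    by (simp add: raag_def)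
  ultimately show "\<exists>y\<in>carrier (raag L). y \<otimes>\<^bsub>raag L\<^esub> x = \<one>\<^bsub>raag L\<^esub>"
    by metis
next
  fix x y assume "x \<in> carrier (raag L)" "y \<in> carrier (raag L)"
  then obtain a b where "a \<in> lists (\<Union>L \<times> UNIV)" "b \<in> lists (\<Union>L \<times> UNIV)"
      "x = raag_class L a" "y = raag_class L b"
    by (auto simp: raag_def)
  then show "x \<otimes>\<^bsub>raag L\<^esub> y \<in> carrier (raag L)"
    by (simp add: raag_mult_class) (auto simp: raag_def)
next
  show "\<one>\<^bsub>raag L\<^esub> \<in> carrier (raag L)"
    by (auto simp: raag_def)
next
  fix x y z assume "x \<in> carrier (raag L)" "y \<in> carrier (raag L)" "z \<in> carrier (raag L)"
  then obtain a b c where "x = raag_class L a" "y = raag_class L b" "z = raag_class L c"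
    by (auto simp: raag_def)
  then show "x \<otimes>\<^bsub>raag L\<^esub> y \<otimes>\<^bsub>raag L\<^esub> z = x \<otimes>\<^bsub>raag L\<^esub> (y \<otimes>\<^bsub>raag L\<^esub> z)"
    by (simp add: raag_mult_class)
next
  fix x assume "x \<in> carrier (raag L)"
  then obtain w where "x = raag_class L w"
    by (auto simp: raag_def)
  moreover have "\<one>\<^bsub>raag L\<^esub> = raag_class L []"
    by (simp add: raag_def)
  ultimately show "\<one>\<^bsub>raag L\<^esub> \<otimes>\<^bsub>raag L\<^esub> x = x"
    by (simp add: raag_mult_class)
qed

section \<open>Toric complexes and their infinite cyclic covers\<close>

text \<open>\<open>S\<^sup>1\<close> is the unit circle in the complex plane, with \<open>0\<close>-cell \<open>1\<close>. The torus
  \<open>(S\<^sup>1)\<^sup>V\<close> for \<open>V = \<Union>L\<close> is realised inside the function space with the product topology,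
  by letting the coordinates outside \<open>V\<close> be \<open>1\<close>.\<close>

definition toric_complex :: "'v set set \<Rightarrow> ('v \<Rightarrow> complex) set" where
  "toric_complex L = (\<Union>\<sigma>\<in>L. {x. (\<forall>v. x v \<in> sphere 0 1) \<and> (\<forall>v. v \<notin> \<sigma> \<longrightarrow> x v = 1)})"

text \<open>The generator \<open>v\<close> of \<open>\<pi>\<^sub>1(T\<^sub>L) = G\<^sub>L\<close> is the loop running once around the
  \<open>v\<close>-th circle. On \<open>\<pi>\<^sub>1\<close>, the map \<open>x \<mapsto> \<Prod>\<^sub>v x\<^sub>v\<^bsup>chi(v)\<^esup>\<close> from \<open>T\<^sub>L\<close> to \<open>S\<^sup>1\<close> therefore induces
  \<open>chi\<close>.\<close>

definition toric_char :: "'v set set \<Rightarrow> ('v word set \<Rightarrow> int) \<Rightarrow> ('v \<Rightarrow> complex) \<Rightarrow> complex" where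
  "toric_char L chi x = (\<Prod>v\<in>\<Union>L. x v powi chi (raag_gen L v))"

text \<open>\<open>T\<^sub>L\<^sup>chi\<close> is the pullback of the universal cover \<open>\<real> \<rightarrow> S\<^sup>1\<close>, \<open>s \<mapsto> exp(2\<pi>is)\<close>, along this map;
  the covering projection is \<open>fst\<close>, and \<open>n \<in> \<int>\<close> acts by the deck transformation
  \<open>(x, s) \<mapsto> (x, s + n)\<close>. The lemmas below check that this is the (connected) infinite
  cyclic cover belonging to \<open>ker chi\<close>.\<close>

definition toric_cover ::
    "'v set set \<Rightarrow> ('v word set \<Rightarrow> int) \<Rightarrow> (('v \<Rightarrow> complex) \<times> real) set" where
  "toric_cover L chi = {(x, s). x \<in> toric_complex L \<and> toric_char L chi x = cis (2 * pi * s)}"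

definition deck :: "int \<Rightarrow> 'b \<times> real \<Rightarrow> 'b \<times> real" where
  "deck n = (\<lambda>(x, s). (x, s + of_int n))"


lemma finite_vertices: "finite_simplicial_complex L \<Longrightarrow> finite (\<Union>L)"
  by (auto simp: finite_simplicial_complex_def)

lemma continuous_on_toric_char: "continuous_on (toric_complex L) (toric_char L chi)"
  unfolding toric_char_def
proof (intro continuous_on_prod continuous_on_power_int)
  show "continuous_on (toric_complex L) (\<lambda>x. x v)" for v
    by (rule continuous_on_subset[OF continuous_on_product_coordinates]) auto
  have "x v \<noteq> 0" if "x \<in> toric_complex L" for x v
  proof -
    have "norm (x v) = 1" using that by (auto simp: toric_complex_def)
    then show ?thesis by auto
  qed
  then show "0 \<le> chi (raag_gen L v) \<or> (\<forall>x\<in>toric_complex L. x v \<noteq> 0)" for v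
    by blast
qed

lemma norm_toric_char: "x \<in> toric_complex L \<Longrightarrow> norm (toric_char L chi x) = 1"
  unfolding toric_char_def prod_norm[symmetric]
  by (intro prod.neutral) (auto simp: toric_complex_def norm_power_int)

lemma toric_cover_fibre:
  assumes "(x, s) \<in> toric_cover L chi"
  shows "(x, s') \<in> toric_cover L chi \<longleftrightarrow> (\<exists>n. (x, s') = deck n (x, s))"
proof -
  have "cis (2 * pi * s') = cis (2 * pi * s) \<longleftrightarrow> (\<exists>n::int. s' = s + n)"
  proof
    assume "cis (2 * pi * s') = cis (2 * pi * s)"
    then have "cis (2 * pi * (s' - s)) = 1"
      unfolding right_diff_distrib cis_divide[symmetric] by simp
    then have "cos (2 * pi * (s' - s)) = 1"
      by (simp only: complex_eq_iff cis.sel one_complex.sel)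
    then obtain n :: int where "2 * pi * (s' - s) = n * 2 * pi"
      using cos_one_2pi_int by auto
    then have "(2 * pi) * (s' - s) = (2 * pi) * n"
      by (simp add: mult_ac)
    then have "s' - s = n"
      by (subst (asm) mult_cancel_left) auto
    then show "\<exists>n::int. s' = s + n"
      by (intro exI[of _ n]) simp
  next
    assume "\<exists>n::int. s' = s + n"
    then obtain n :: int where "s' = s + n" ..
    then have "2 * pi * s' = 2 * pi * s + 2 * pi * n"
      by (simp add: distrib_left)
    then have "cis (2 * pi * s') = cis (2 * pi * s) * cis (2 * pi * n)"
      by (simp only: cis_mult)
    then show "cis (2 * pi * s') = cis (2 * pi * s)"
      by simp
  qed
  with assms show ?thesis
    by (auto simp: toric_cover_def deck_def)
qed

lemma homeomorphism_deck:
  "homeomorphism (toric_cover L chi) (toric_cover L chi) (deck n) (deck (- n))"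
proof -
  have *: "deck k p \<in> toric_cover L chi" if "p \<in> toric_cover L chi" for k p
    using that toric_cover_fibre[of "fst p" "snd p" L chi "snd p + k"]
    by (auto simp: deck_def case_prod_beta)
  have cont: "continuous_on (toric_cover L chi) (deck k)" for k
    unfolding deck_def case_prod_beta by (intro continuous_intros)
  show ?thesis
    by (rule homeomorphismI) (use *[of _ n] *[of _ "- n"] cont[of n] cont[of "- n"] in
      \<open>auto simp: deck_def\<close>)
qed

lemma covering_space_toric_cover: "covering_space (toric_cover L chi) fst (toric_complex L)"
proof (rule covering_spaceI)
  let ?T = "toric_complex L" and ?E = "toric_cover L chi" and ?h = "toric_char L chi"
  have lift: "\<exists>s. ?h x = cis (2 * pi * s)" if "x \<in> ?T" for x
  proof -
    have "?h x = cis (2 * pi * (Arg (?h x) / (2 * pi)))"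
      using rcis_cmod_Arg[of "?h x"] norm_toric_char[OF that, of chi] by (simp add: rcis_def)
    then show ?thesis by blast
  qed
  show "continuous_on ?E fst"
    by (intro continuous_intros)
  show "fst ` ?E = ?T"
    using lift by (force simp: toric_cover_def)
  fix x0 assume x0: "x0 \<in> ?T"
  obtain s0 where s0: "?h x0 = cis (2 * pi * s0)"
    using lift[OF x0] by blast
  define U where "U = {x \<in> ?T. 0 < Re (?h x / ?h x0)}"
  define l where "l x = s0 + Arg (?h x / ?h x0) / (2 * pi)" for x
  define W where "W n = {(x, s). x \<in> U \<and> s = l x + of_int n}" for n
  have h0: "?h x0 \<noteq> 0"
    using norm_toric_char[OF x0, of chi] by auto
  have UT: "U \<subseteq> ?T"
    by (auto simp: U_def)
  have cont_quot: "continuous_on ?T (\<lambda>x. ?h x / ?h x0)"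
    using h0 by (intro continuous_intros continuous_on_toric_char) auto
  have U_open: "openin (top_of_set ?T) U"
  proof -
    have "openin (top_of_set ?T) (?T \<inter> (\<lambda>x. Re (?h x / ?h x0)) -` {0<..})"
      by (intro continuous_openin_preimage_gen continuous_on_Re cont_quot open_greaterThan)
    then show ?thesis
      by (simp add: U_def vimage_def Int_def)
  qed
  have cont_l: "continuous_on U l"
  proof -
    have "continuous_on U (\<lambda>x. Arg (?h x / ?h x0))"
      by (rule continuous_on_Arg'[OF continuous_on_subset[OF cont_quot UT]])
        (auto simp: U_def complex_nonpos_Reals_iff)
    then show ?thesis
      unfolding l_def by (intro continuous_on_add continuous_on_const continuous_on_divide) auto
  qed
  have l_cover: "(x, l x) \<in> ?E" if "x \<in> U" for x
  proof -
    have x: "x \<in> ?T" using that UT by blast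
    have "norm (?h x / ?h x0) = 1"
      using x x0 by (simp add: norm_divide norm_toric_char)
    then have "cis (Arg (?h x / ?h x0)) = ?h x / ?h x0"
      using rcis_cmod_Arg[of "?h x / ?h x0"] by (simp add: rcis_def)
    moreover have "2 * pi * l x = 2 * pi * s0 + Arg (?h x / ?h x0)"
      by (simp add: l_def field_simps)
    ultimately have "cis (2 * pi * l x) = ?h x"
      using h0 by (simp add: s0 flip: cis_mult)
    with x show ?thesis
      by (simp add: toric_cover_def)
  qed
  have in_E_iff: "(x, s) \<in> ?E \<longleftrightarrow> (\<exists>n. (x, s) \<in> W n)" if "x \<in> U" for x s
    using toric_cover_fibre[OF l_cover[OF that], of s] that by (auto simp: W_def deck_def)
  have E_U: "\<Union> (range W) = ?E \<inter> fst -` U"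
    using in_E_iff by (fastforce simp: W_def)
  have E_U_open: "openin (top_of_set ?E) (?E \<inter> fst -` U)"
    by (rule continuous_openin_preimage[OF _ _ U_open])
      (auto intro: continuous_on_fst[OF continuous_on_id] simp: toric_cover_def)
  have "openin (top_of_set ?E) (W n)" for n
  proof -
    let ?D = "?E \<inter> fst -` U"
    have "continuous_on ?D (\<lambda>p. snd p - l (fst p))"
      by (intro continuous_intros continuous_on_compose2[OF cont_l]) auto
    then have "openin (top_of_set ?D) (?D \<inter> (\<lambda>p. snd p - l (fst p)) -` {real_of_int n - 1/2<..<real_of_int n + 1/2})"
      by (intro continuous_openin_preimage_gen open_greaterThanLessThan)
    also have "?D \<inter> (\<lambda>p. snd p - l (fst p)) -` {real_of_int n - 1/2<..<real_of_int n + 1/2} = W n"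
    proof (rule Set.set_eqI)
      fix p :: "('a \<Rightarrow> complex) \<times> real"
      have "m = n" if "real_of_int n - 1/2 < real_of_int m" "real_of_int m < real_of_int n + 1/2"
        for m using that by linarith
      then show "p \<in> ?D \<inter> (\<lambda>p. snd p - l (fst p)) -` {real_of_int n - 1/2<..<real_of_int n + 1/2}
          \<longleftrightarrow> p \<in> W n"
        unfolding E_U[symmetric] by (auto simp: W_def)
    qed
    finally show ?thesis
      using E_U_open by (rule openin_trans)
  qed
  moreover have "pairwise disjnt (range W)"
    by (auto simp: pairwise_def disjnt_def W_def)
  moreover have "homeomorphism (W n) U fst (\<lambda>x. (x, l x + of_int n))" for n
    by (rule homeomorphismI) (auto simp: W_def intro!: continuous_on_Pair
        continuous_on_fst continuous_on_add continuous_on_const continuous_on_id cont_l)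
  moreover have "x0 \<in> U"
    using x0 h0 by (simp add: U_def)
  ultimately show "\<exists>T. x0 \<in> T \<and> openin (top_of_set ?T) T \<and>
      (\<exists>v. \<Union>v = ?E \<inter> fst -` T \<and> (\<forall>u\<in>v. openin (top_of_set ?E) u) \<and>
        pairwise disjnt v \<and> (\<forall>u\<in>v. \<exists>q. homeomorphism u T fst q))"
    using U_open E_U by (intro exI[of _ U] conjI exI[of _ "range W"]) auto
qed

text \<open>The generating loop of the \<open>v\<close>-th circle lifts to a path from height \<open>n\<close> to height
  \<open>n + chi(v)\<close>, so the monodromy of the cover is \<open>chi\<close>.\<close>

lemma toric_cover_lift_loop:
  fixes chi :: "'v word set \<Rightarrow> int"
  assumes "finite_simplicial_complex L" "v \<in> \<Union>L"
  defines "\<gamma> n \<equiv> \<lambda>u. ((\<lambda>_. 1)(v := cis (2 * pi * u)), of_int n + of_int (chi (raag_gen L v)) * u)"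
  shows "path (\<gamma> n)" "path_image (\<gamma> n) \<subseteq> toric_cover L chi"
    "pathstart (\<gamma> n) = (\<lambda>_. 1, of_int n)"
    "pathfinish (\<gamma> n) = deck (chi (raag_gen L v)) (\<lambda>_. 1, of_int n)"
proof -
  have "continuous_on {0..1} (\<lambda>u. ((\<lambda>_. 1)(v := cis (2 * pi * u))) w)" for w
    by (cases "w = v") (auto intro!: continuous_intros)
  then show "path (\<gamma> n)"
    unfolding \<gamma>_def path_def by (intro continuous_intros continuous_on_coordinatewise_then_product)
  show "path_image (\<gamma> n) \<subseteq> toric_cover L chi"
  proof -
    have "{v} \<in> L"
      using assms(1,2) by (auto simp: finite_simplicial_complex_def)
    then have in_T: "(\<lambda>_. 1)(v := cis (2 * pi * u)) \<in> toric_complex L" for u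
      unfolding toric_complex_def by (rule UN_I) auto
    have "toric_char L chi ((\<lambda>_. 1)(v := cis (2 * pi * u)))
        = (\<Prod>w\<in>\<Union>L. if w = v then cis (2 * pi * u) powi chi (raag_gen L v) else 1)" for u
      unfolding toric_char_def by (rule prod.cong) auto
    then have powi: "toric_char L chi ((\<lambda>_. 1)(v := cis (2 * pi * u)))
        = cis (2 * pi * u) powi chi (raag_gen L v)" for u
      using assms(2) finite_vertices[OF assms(1)] by simp
    have char: "toric_char L chi ((\<lambda>_. 1)(v := cis (2 * pi * u)))
        = cis (2 * pi * (of_int (chi (raag_gen L v)) * u))" for u
      unfolding powi cis_power_int by (simp only: mult_ac)
    have "cis (2 * pi * (of_int n + of_int (chi (raag_gen L v)) * u))
        = cis (2 * pi * of_int n) * cis (2 * pi * (of_int (chi (raag_gen L v)) * u))" for u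
      by (simp only: cis_mult distrib_left)
    then have "\<gamma> n u \<in> toric_cover L chi" for u
      unfolding \<gamma>_def toric_cover_def using in_T[of u] char[of u]
      by simp
    then show ?thesis
      by (auto simp: path_image_def)
  qed
  show "pathstart (\<gamma> n) = (\<lambda>_. 1, of_int n)"
    by (auto simp: \<gamma>_def pathstart_def)
  show "pathfinish (\<gamma> n) = deck (chi (raag_gen L v)) (\<lambda>_. 1, of_int n)"
    by (auto simp: \<gamma>_def pathfinish_def deck_def)
qed

lemma toric_cover_word:
  assumes L: "finite_simplicial_complex L" and chi: "chi \<in> hom (raag L) integer_group"
    and w: "w \<in> lists (\<Union>L \<times> UNIV)"
  shows "path_component (toric_cover L chi) (\<lambda>_. 1, of_int n)
           (\<lambda>_. 1, of_int (n + chi (raag_class L w)))"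
  using w
proof (induction w arbitrary: n)
  case Nil
  have "chi (raag_class L [] \<otimes>\<^bsub>raag L\<^esub> raag_class L [])
      = chi (raag_class L []) + chi (raag_class L [])"
    using hom_mult[OF chi, of "raag_class L []" "raag_class L []"]
    by (auto simp: raag_def integer_group_def)
  then have "chi (raag_class L []) = 0"
    by (simp add: raag_mult_class)
  moreover have "(\<lambda>_. 1, of_int n) \<in> toric_cover L chi"
    using L by (auto simp: toric_cover_def toric_complex_def toric_char_def finite_simplicial_complex_def)
  ultimately show ?case
    by (simp add: path_component_refl)
next
  case (Cons x w)
  obtain v b where x: "x = (v, b)" by fastforce
  have v: "v \<in> \<Union>L" using Cons.hyps x by auto
  have w: "w \<in> lists (\<Union>L \<times> UNIV)" using Cons.hyps by auto
  have add: "chi (raag_class L (a @ c)) = chi (raag_class L a) + chi (raag_class L c)"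
    if "a \<in> lists (\<Union>L \<times> UNIV)" "c \<in> lists (\<Union>L \<times> UNIV)" for a c
    using hom_mult[OF chi, of "raag_class L a" "raag_class L c"] that
    by (simp add: raag_mult_class) (auto simp: raag_def integer_group_def)
  have edge: "path_component (toric_cover L chi) (\<lambda>_. 1, of_int k)
      (\<lambda>_. 1, of_int (k + chi (raag_gen L v)))" for k
    unfolding path_component_def
    by (rule exI, intro conjI, rule toric_cover_lift_loop(1)[OF L v],
        rule toric_cover_lift_loop(2)[OF L v], rule toric_cover_lift_loop(3)[OF L v])
      (simp add: toric_cover_lift_loop(4)[OF L v] deck_def)
  have inv: "chi (raag_class L [(v, False)]) = - chi (raag_gen L v)"
  proof -
    have "raag_class L ([(v, True)] @ [(v, False)]) = raag_class L []"
      unfolding raag_class_eq_iff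
      using raag_step.cancel[OF v, of "[]" True "[]"] by (auto intro: r_into_equivclp)
    moreover have "chi (raag_class L []) = 0"
      using add[of "[]" "[]"] by simp
    ultimately show ?thesis
      using add[of "[(v, True)]" "[(v, False)]"] v by (simp add: raag_gen_def)
  qed
  have *: "path_component (toric_cover L chi) (\<lambda>_. 1, of_int n)
      (\<lambda>_. 1, of_int (n + chi (raag_class L [x])))"
  proof (cases b)
    case True
    then show ?thesis using edge[of n] by (simp add: x raag_gen_def)
  next
    case False
    then show ?thesis
      using edge[of "n - chi (raag_gen L v)"] by (simp add: x inv path_component_sym)
  qed
  have "chi (raag_class L (x # w)) = chi (raag_class L [x]) + chi (raag_class L w)"
    using add[of "[x]" w] w v x by simp
  then show ?case
    using path_component_trans[OF * Cons.IH] by (simp only: add.assoc)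
qed

lemma path_connected_toric_cover:
  assumes L: "finite_simplicial_complex L" and chi: "chi \<in> epi (raag L) integer_group"
  shows "path_connected (toric_cover L chi)"
proof -
  let ?E = "toric_cover L chi"
  have hom: "chi \<in> hom (raag L) integer_group" and surj: "chi ` carrier (raag L) = UNIV"
    using chi by (auto simp: epi_def integer_group_def)
  have to_base: "path_component ?E (x, s) (\<lambda>_. 1, 0)" if xs: "(x, s) \<in> ?E" for x s
  proof -
    define \<theta> where "\<theta> v = Arg (x v)" for v
    define \<gamma> where "\<gamma> u = ((\<lambda>v. cis ((1 - u) * \<theta> v)),
      s - u * (\<Sum>v\<in>\<Union>L. of_int (chi (raag_gen L v)) * \<theta> v) / (2 * pi))" for u :: real
    from xs obtain \<sigma> where \<sigma>: "\<sigma> \<in> L" "\<And>v. x v \<in> sphere 0 1" "\<And>v. v \<notin> \<sigma> \<Longrightarrow> x v = 1"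
      by (auto simp: toric_cover_def toric_complex_def)
    have x_eq: "x v = cis (\<theta> v)" for v
      using rcis_cmod_Arg[of "x v"] \<sigma>(2)[of v] by (simp add: rcis_def \<theta>_def)
    have char: "toric_char L chi (\<lambda>v. cis (c * \<theta> v))
        = cis (c * (\<Sum>v\<in>\<Union>L. of_int (chi (raag_gen L v)) * \<theta> v))" for c
    proof -
      have "(\<Prod>v\<in>A. cis (g v)) = cis (\<Sum>v\<in>A. g v)" if "finite A" for A and g :: "'a \<Rightarrow> real"
        using that by induction (simp_all add: cis_mult)
      then show ?thesis
        using finite_vertices[OF L]
        by (simp add: toric_char_def cis_power_int sum_distrib_left mult_ac)
    qed
    have x_fun: "x = (\<lambda>v. cis (\<theta> v))"
      using x_eq by auto
    then have s: "cis (2 * pi * s) = cis (\<Sum>v\<in>\<Union>L. of_int (chi (raag_gen L v)) * \<theta> v)"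
      using xs char[of 1] by (simp add: toric_cover_def)
    have \<gamma>_in: "\<gamma> u \<in> ?E" for u
    proof -
      have "(\<lambda>v. cis ((1 - u) * \<theta> v)) \<in> toric_complex L"
        unfolding toric_complex_def using \<sigma> by (intro UN_I[of \<sigma>]) (auto simp: \<theta>_def)
      moreover have "cis (2 * pi * snd (\<gamma> u)) = cis (2 * pi * s)
          / cis (u * (\<Sum>v\<in>\<Union>L. of_int (chi (raag_gen L v)) * \<theta> v))"
        by (simp add: \<gamma>_def right_diff_distrib cis_divide)
      ultimately show ?thesis
        using char[of "1 - u"] by (simp add: toric_cover_def \<gamma>_def s cis_divide left_diff_distrib)
    qed
    have "path \<gamma>"
      unfolding \<gamma>_def path_def
      by (intro continuous_intros continuous_on_coordinatewise_then_product) auto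
    moreover note \<gamma>_in
    moreover have "\<gamma> 0 = (x, s)"
      by (simp add: \<gamma>_def x_fun[symmetric])
    ultimately have *: "path_component ?E (x, s) (\<gamma> 1)"
      unfolding path_component_def
      by (intro exI[of _ \<gamma>]) (auto simp: path_image_def pathstart_def pathfinish_def)
    obtain s' where s': "\<gamma> 1 = (\<lambda>_. 1, s')"
      by (auto simp: \<gamma>_def)
    have "(\<lambda>_. 1, 0) \<in> ?E"
      using L by (auto simp: toric_cover_def toric_complex_def toric_char_def finite_simplicial_complex_def)
    then obtain n :: int where n: "s' = of_int n"
      using toric_cover_fibre[of "\<lambda>_. 1" 0 L chi s'] \<gamma>_in[of 1] s'
      by (auto simp: deck_def)
    obtain w where w: "w \<in> lists (\<Union>L \<times> UNIV)" "chi (raag_class L w) = - n"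
    proof -
      have "- n \<in> chi ` raag_class L ` lists (\<Union>L \<times> UNIV)"
        using surj by (simp add: raag_def)
      then obtain A where A: "- n = chi A" "A \<in> raag_class L ` lists (\<Union>L \<times> UNIV)"
        by (rule imageE)
      from A(2) obtain w where "A = raag_class L w" "w \<in> lists (\<Union>L \<times> UNIV)"
        by (rule imageE)
      with A(1) that show ?thesis by simp
    qed
    then show ?thesis
      using path_component_trans[OF *[unfolded s' n] toric_cover_word[OF L hom w(1)]] by simp
  qed
  show ?thesis
    unfolding path_connected_component
  proof (intro ballI)
    fix p q assume "p \<in> ?E" "q \<in> ?E"
    then show "path_component ?E p q"
      using path_component_trans[OF to_base path_component_sym[OF to_base],
          of "fst p" "snd p" "fst q" "snd q"] by simp
  qed
qed

section \<open>Singular homology over a field as a Laurent polynomial module\<close>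

text \<open>\<open>k[t, t\<^sup>-\<^sup>1]\<close> is the convolution ring \<open>int \<Rightarrow>\<^sub>0 'k\<close>, i.e. the group ring of \<open>\<int>\<close>,
  with \<open>t = Poly_Mapping.single 1 1\<close>.\<close>

definition laurent_ring :: "(int \<Rightarrow>\<^sub>0 'k::field) ring" where
  "laurent_ring = \<lparr>carrier = UNIV, monoid.mult = (*), monoid.one = 1, ring.zero = 0, ring.add = (+)\<rparr>"

definition laurent_of_poly :: "'k::field poly \<Rightarrow> (int \<Rightarrow>\<^sub>0 'k)" where
  "laurent_of_poly f = (\<Sum>j\<le>Polynomial.degree f. Poly_Mapping.single (int j) (poly.coeff f j))"

text \<open>Singular chains with coefficients in \<open>k\<close>; the library only has integer coefficients.\<close>

type_synonym ('a, 'k) kchain = "((nat \<Rightarrow> real) \<Rightarrow> 'a) \<Rightarrow>\<^sub>0 'k"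

definition linear_extend :: "('b \<Rightarrow> ('c \<Rightarrow>\<^sub>0 'k)) \<Rightarrow> ('b \<Rightarrow>\<^sub>0 'k) \<Rightarrow> ('c \<Rightarrow>\<^sub>0 'k::comm_ring_1)" where
  "linear_extend \<phi> c =
     (\<Sum>b\<in>Poly_Mapping.keys c. Poly_Mapping.map ((*) (Poly_Mapping.lookup c b)) (\<phi> b))"

definition kchains :: "nat \<Rightarrow> 'a topology \<Rightarrow> ('a, 'k::field) kchain set" where
  "kchains p S = {c. Poly_Mapping.keys c \<subseteq> singular_simplex_set p S}"

definition kboundary :: "nat \<Rightarrow> ('a, 'k::field) kchain \<Rightarrow> ('a, 'k) kchain" where
  "kboundary p c = (if p = 0 then 0 else
     linear_extend (\<lambda>\<sigma>. \<Sum>j\<le>p. Poly_Mapping.single (singular_face p j \<sigma>) ((-1) ^ j)) c)"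

definition kcycles :: "nat \<Rightarrow> 'a topology \<Rightarrow> ('a, 'k::field) kchain set" where
  "kcycles p S = {c \<in> kchains p S. kboundary p c = 0}"

definition kboundaries :: "nat \<Rightarrow> 'a topology \<Rightarrow> ('a, 'k::field) kchain set" where
  "kboundaries p S = kboundary (Suc p) ` kchains (Suc p) S"

definition laurent_act ::
    "nat \<Rightarrow> (int \<Rightarrow> 'a \<Rightarrow> 'a) \<Rightarrow> (int \<Rightarrow>\<^sub>0 'k) \<Rightarrow> ('a, 'k::field) kchain \<Rightarrow> ('a, 'k) kchain" where
  "laurent_act p T q c =
     (\<Sum>n\<in>Poly_Mapping.keys q.
        linear_extend (\<lambda>\<sigma>. Poly_Mapping.single (simplex_map p (T n) \<sigma>) (Poly_Mapping.lookup q n)) c)"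

definition hclass :: "nat \<Rightarrow> 'a topology \<Rightarrow> ('a, 'k::field) kchain \<Rightarrow> ('a, 'k) kchain set" where
  "hclass p S z = (+) z ` kboundaries p S"

text \<open>\<open>H\<^sub>p(S; k)\<close>, for an action \<open>T\<close> of \<open>\<int>\<close> on \<open>S\<close>. The fields \<open>mult\<close> and \<open>one\<close> of a module
  record play no role in \<^locale>\<open>module\<close>.\<close>

definition khomology ::
    "nat \<Rightarrow> 'a topology \<Rightarrow> (int \<Rightarrow> 'a \<Rightarrow> 'a) \<Rightarrow> (int \<Rightarrow>\<^sub>0 'k::field, ('a, 'k) kchain set) module" where
  "khomology p S T =
     \<lparr>carrier = hclass p S ` kcycles p S,
      monoid.mult = (\<lambda>A B. kboundaries p S), monoid.one = kboundaries p S,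
      ring.zero = kboundaries p S,
      ring.add = (\<lambda>A B. {a + b | a b. a \<in> A \<and> b \<in> B}),
      module.smult = (\<lambda>q A. \<Union>a\<in>A. hclass p S (laurent_act p T q a))\<rparr>"

definition primary_part :: "('r, 's) ring_scheme \<Rightarrow> ('r, 'm, 'u) module_scheme \<Rightarrow> 'r \<Rightarrow> 'm set" where
  "primary_part R M f =
     {x \<in> carrier M. \<exists>N::nat. (f [^]\<^bsub>R\<^esub> N) \<odot>\<^bsub>M\<^esub> x = \<zero>\<^bsub>M\<^esub>}"

text \<open>\<open>H\<^sub>i(T\<^sub>L, k\<int>\<^sub>chi)\<close>. Since \<open>k\<int>\<^sub>chi \<otimes>\<^bsub>kG\<^esub> C(U; k)\<close>, with \<open>U\<close> the universal cover of \<open>T\<^sub>L\<close>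
  and \<open>G = G\<^sub>L\<close>, is the complex \<open>C(U / ker chi; k)\<close> of chains on \<open>T\<^sub>L\<^sup>chi\<close>, this is the homology of
  \<open>T\<^sub>L\<^sup>chi\<close> with \<open>t\<close> acting by the generating deck transformation.\<close>

definition toric_homology ::
    "'v set set \<Rightarrow> ('v word set \<Rightarrow> int) \<Rightarrow> nat \<Rightarrow>
      (int \<Rightarrow>\<^sub>0 'k::field, (('v \<Rightarrow> complex) \<times> real, 'k) kchain set) module" where
  "toric_homology L chi i = khomology i (top_of_set (toric_cover L chi)) deck"

end

theory Submission
  imports Defs
begin

text \<open>
  Let \<open>K\<close> be the suspension of an \<open>n\<close>-simplex: the suspension points are \<open>0\<close> and \<open>1\<close>, the
  simplex has the vertices \<open>2, \<dots>, n + 2\<close>. Its toric complex is the product of a wedge of two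
  circles with \<open>n + 1\<close> further circles. Let \<open>chi\<close> take the value \<open>1\<close> on the suspension points,
  \<open>m\<close> on the vertex \<open>2\<close>, and \<open>0\<close> on the remaining vertices. The homology in degree \<open>n + 1\<close> of
  the infinite cyclic cover then contains a copy of \<open>k[t]/(t\<^sup>m - 1)\<close>, as follows.

  \<^item> The vertex \<open>2\<close> spans a simplex with every simplex of \<open>K\<close>, so its circle can be rotated
    freely. A full turn lifts to a homotopy from the identity of the cover to \<open>t\<^sup>m\<close>
    (\<open>cone_flow\<close>), hence \<open>t\<^sup>m - 1\<close> annihilates the homology of the cover.
  \<^item> The two circles of the wedge lift to paths with common end points. Their difference is a
    loop, and its product with the \<open>n\<close> circles of weight \<open>0\<close> is an \<open>(n + 1)\<close>-cycle \<open>c\<close>.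
  \<^item> The translates \<open>c, t c, \<dots>, t\<^bsup>m - 1\<^esup> c\<close> are told apart by a cocycle (\<open>detected_cycle\<close>).
    Up to homotopy the cover is the product of \<open>n\<close> circles with a graph, the \<open>m\<close>-fold cyclic
    cover of the wedge. Collapsing the graph to a single one of its edges gives a map to a
    circle, and together with the \<open>n\<close> coordinates a map to a torus of dimension \<open>n + 1\<close>. The
    fundamental cocycle of the torus pulls back to a cocycle that is \<open>1\<close> on \<open>c\<close> and \<open>0\<close> on
    \<open>t\<^sup>l c\<close> for \<open>0 < l < m\<close>.

  If now \<open>t\<^sup>m - 1 = f q\<close>, then the class of \<open>q c\<close> is killed by \<open>f\<close>. It is not zero, because
  \<open>q\<close> has degree less than \<open>m\<close>, so that the cocycle takes the value \<open>q(0)\<close> on \<open>q c\<close>, and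
  \<open>f(0) q(0) = - 1\<close>.

  Two explicit constructions carry the argument on the level of singular chains. The prism
  operator of a homotopy serves twice: for the flow that turns \<open>t\<^sup>m c - c\<close> into a boundary,
  and for the product of a cycle with a circle, where the homotopy is a rotation that returns
  to the identity (\<open>kboundary_prism\<close>). The fundamental cocycle of the torus is the cup
  product of the integral degree-one classes of the coordinates, which counts how often the
  edges of a simplex wind around the circles (\<open>cup_cocycle\<close>). In this form a rotation prism
  contributes exactly one term (\<open>pairing_cup_prism\<close>), and its values are integers, so that it
  makes sense over every field.
\<close>

section \<open>Linear algebra of chains\<close>

definition kscale :: "'k \<Rightarrow> ('b \<Rightarrow>\<^sub>0 'k) \<Rightarrow> ('b \<Rightarrow>\<^sub>0 'k::comm_ring_1)" where
  "kscale a = Poly_Mapping.map ((*) a)"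

definition pairing :: "('b \<Rightarrow> 'k) \<Rightarrow> ('b \<Rightarrow>\<^sub>0 'k) \<Rightarrow> 'k::comm_ring_1" where
  "pairing \<phi> c = (\<Sum>b\<in>Poly_Mapping.keys c. Poly_Mapping.lookup c b * \<phi> b)"

lemma lookup_kscale [simp]: "Poly_Mapping.lookup (kscale a c) x = a * Poly_Mapping.lookup c x"
  unfolding kscale_def by transfer (simp add: when_def)

lemma pairing_superset:
  assumes "finite A" "Poly_Mapping.keys c \<subseteq> A"
  shows "pairing \<phi> c = (\<Sum>b\<in>A. Poly_Mapping.lookup c b * \<phi> b)"
  unfolding pairing_def using assms by (intro sum.mono_neutral_left) (auto simp: in_keys_iff)

lemma pairing_add: "pairing \<phi> (c + d) = pairing \<phi> c + pairing \<phi> d"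
proof -
  let ?A = "Poly_Mapping.keys c \<union> Poly_Mapping.keys d"
  have "Poly_Mapping.keys (c + d) \<subseteq> ?A" by (rule keys_add)
  then show ?thesis
    by (simp add: pairing_superset[of ?A] lookup_add distrib_right sum.distrib)
qed

lemma pairing_0 [simp]: "pairing \<phi> 0 = 0"
  by (simp add: pairing_def)

lemma pairing_single [simp]: "pairing \<phi> (Poly_Mapping.single b a) = a * \<phi> b"
  by (cases "a = 0") (simp_all add: pairing_def)

lemma pairing_scale: "pairing \<phi> (kscale a c) = a * pairing \<phi> c"
proof -
  have "Poly_Mapping.keys (kscale a c) \<subseteq> Poly_Mapping.keys c"
    by (auto simp: in_keys_iff)
  then show ?thesis
    by (simp add: pairing_superset[of "Poly_Mapping.keys c"] sum_distrib_left mult_ac)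
qed

lemma pairing_sum: "pairing \<phi> (sum f A) = (\<Sum>x\<in>A. pairing \<phi> (f x))"
  by (induction A rule: infinite_finite_induct) (auto simp: pairing_add)

lemma pairing_diff: "pairing \<phi> (c - d) = pairing \<phi> c - pairing \<phi> d"
  using pairing_add[of \<phi> "c - d" d] by simp

lemma pairing_cong:
  "(\<And>b. b \<in> Poly_Mapping.keys c \<Longrightarrow> \<phi> b = \<psi> b) \<Longrightarrow> pairing \<phi> c = pairing \<psi> c"
  unfolding pairing_def by (rule sum.cong) auto

lemma lookup_linear_extend:
  "Poly_Mapping.lookup (linear_extend \<phi> c) x = pairing (\<lambda>b. Poly_Mapping.lookup (\<phi> b) x) c"
  unfolding linear_extend_def kscale_def[symmetric] by (simp add: lookup_sum pairing_def)

lemma linear_extend_add: "linear_extend \<phi> (c + d) = linear_extend \<phi> c + linear_extend \<phi> d"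
  by (intro poly_mapping_eqI) (simp add: lookup_linear_extend lookup_add pairing_add)

lemma linear_extend_diff: "linear_extend \<phi> (c - d) = linear_extend \<phi> c - linear_extend \<phi> d"
  by (intro poly_mapping_eqI) (simp add: lookup_linear_extend lookup_minus pairing_diff)

lemma linear_extend_0 [simp]: "linear_extend \<phi> 0 = 0"
  by (simp add: linear_extend_def)

lemma linear_extend_sum: "linear_extend \<phi> (sum f A) = (\<Sum>x\<in>A. linear_extend \<phi> (f x))"
  by (induction A rule: infinite_finite_induct) (auto simp: linear_extend_add)

lemma linear_extend_scale: "linear_extend \<phi> (kscale a c) = kscale a (linear_extend \<phi> c)"
  by (intro poly_mapping_eqI) (simp add: lookup_linear_extend pairing_scale)

lemma linear_extend_single [simp]:
  "linear_extend \<phi> (Poly_Mapping.single b a) = kscale a (\<phi> b)"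
  by (intro poly_mapping_eqI) (simp add: lookup_linear_extend)

lemma kscale_single [simp]:
  "kscale a (Poly_Mapping.single b c) = Poly_Mapping.single b (a * c)"
  by (intro poly_mapping_eqI) (simp add: lookup_single when_def)

lemma kscale_add: "kscale a (c + d) = kscale a c + kscale a d"
  by (intro poly_mapping_eqI) (simp add: lookup_add algebra_simps)

lemma kscale_0 [simp]: "kscale a 0 = 0"
  by (intro poly_mapping_eqI) simp

lemma kscale_0_left [simp]: "kscale 0 c = 0"
  by (intro poly_mapping_eqI) simp

lemma kscale_1 [simp]: "kscale 1 c = c"
  by (intro poly_mapping_eqI) simp

lemma kscale_sum: "kscale a (sum f A) = (\<Sum>x\<in>A. kscale a (f x))"
  by (induction A rule: infinite_finite_induct) (auto simp: kscale_add)

lemma kscale_kscale [simp]: "kscale a (kscale b c) = kscale (a * b) c"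
  by (intro poly_mapping_eqI) (simp add: mult_ac)

lemma pairing_linear_extend: "pairing \<psi> (linear_extend \<phi> c) = pairing (\<lambda>b. pairing \<psi> (\<phi> b)) c"
proof -
  have "pairing \<psi> (linear_extend \<phi> c) = (\<Sum>b\<in>Poly_Mapping.keys c. pairing \<psi> (kscale (Poly_Mapping.lookup c b) (\<phi> b)))"
    unfolding linear_extend_def kscale_def[symmetric] by (simp add: pairing_sum)
  then show ?thesis
    by (simp add: pairing_scale pairing_def[of _ c])
qed

lemma linear_extend_cong:
  "(\<And>b. b \<in> Poly_Mapping.keys c \<Longrightarrow> \<phi> b = \<psi> b) \<Longrightarrow> linear_extend \<phi> c = linear_extend \<psi> c"
  unfolding linear_extend_def by (rule sum.cong) auto

lemma linear_extend_linear_extend: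
  "linear_extend \<psi> (linear_extend \<phi> c) = linear_extend (\<lambda>b. linear_extend \<psi> (\<phi> b)) c"
  by (intro poly_mapping_eqI) (simp add: lookup_linear_extend pairing_linear_extend)

lemma linear_extend_id: "linear_extend (\<lambda>b. Poly_Mapping.single b 1) c = c"
proof (intro poly_mapping_eqI)
  fix x
  have "Poly_Mapping.lookup (linear_extend (\<lambda>b. Poly_Mapping.single b 1) c) x =
     (\<Sum>b\<in>Poly_Mapping.keys c. if b = x then Poly_Mapping.lookup c b else 0)"
    unfolding lookup_linear_extend pairing_def
    by (rule sum.cong) (auto simp: lookup_single when_def)
  then show "Poly_Mapping.lookup (linear_extend (\<lambda>b. Poly_Mapping.single b 1) c) x = Poly_Mapping.lookup c x"
    by (auto simp: in_keys_iff)
qed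

lemma linear_extend_minus:
  "linear_extend (\<lambda>b. \<phi> b - \<psi> b) c = linear_extend \<phi> c - linear_extend \<psi> c"
  by (intro poly_mapping_eqI)
    (simp add: lookup_linear_extend lookup_minus pairing_def right_diff_distrib sum_subtractf)

lemma linear_extend_scale_fun:
  "linear_extend (\<lambda>b. kscale a (\<phi> b)) c = kscale a (linear_extend \<phi> c)"
  by (intro poly_mapping_eqI)
    (simp add: lookup_linear_extend pairing_def sum_distrib_left mult_ac)

lemma keys_linear_extend:
  "Poly_Mapping.keys (linear_extend \<phi> c) \<subseteq> (\<Union>b\<in>Poly_Mapping.keys c. Poly_Mapping.keys (\<phi> b))"
proof
  fix x assume "x \<in> Poly_Mapping.keys (linear_extend \<phi> c)"
  then have "pairing (\<lambda>b. Poly_Mapping.lookup (\<phi> b) x) c \<noteq> 0"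
    by (simp add: in_keys_iff lookup_linear_extend)
  then obtain b where b: "b \<in> Poly_Mapping.keys c" "Poly_Mapping.lookup (\<phi> b) x \<noteq> 0"
    unfolding pairing_def
    by (metis (no_types, lifting) mult_zero_right sum.not_neutral_contains_not_neutral)
  then show "x \<in> (\<Union>b\<in>Poly_Mapping.keys c. Poly_Mapping.keys (\<phi> b))"
    by (auto simp: in_keys_iff)
qed

lemma kchains_0 [simp]: "0 \<in> kchains p S"
  by (simp add: kchains_def)

lemma kchains_single: "singular_simplex p S \<sigma> \<Longrightarrow> Poly_Mapping.single \<sigma> a \<in> kchains p S"
  by (auto simp: kchains_def)

lemma kchains_add: "c \<in> kchains p S \<Longrightarrow> d \<in> kchains p S \<Longrightarrow> c + d \<in> kchains p S"
  unfolding kchains_def using keys_add[of c d] by blast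

lemma kchains_scale: "c \<in> kchains p S \<Longrightarrow> kscale a c \<in> kchains p S"
  by (force simp: kchains_def in_keys_iff)

lemma kchains_diff: "c \<in> kchains p S \<Longrightarrow> d \<in> kchains p S \<Longrightarrow> c - d \<in> kchains p S"
  unfolding kchains_def using keys_diff[of c d] by blast

lemma kchains_sum: "(\<And>x. x \<in> A \<Longrightarrow> f x \<in> kchains p S) \<Longrightarrow> sum f A \<in> kchains p S"
  by (induction A rule: infinite_finite_induct) (auto intro: kchains_add)

lemma kchains_linear_extend:
  assumes "c \<in> kchains p S" and "\<And>\<sigma>. singular_simplex p S \<sigma> \<Longrightarrow> \<phi> \<sigma> \<in> kchains q R"
  shows "linear_extend \<phi> c \<in> kchains q R"
  using keys_linear_extend[of \<phi> c] assms by (fastforce simp: kchains_def)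

lemma kboundary_Suc:
  "kboundary (Suc p) = linear_extend (\<lambda>\<sigma>. \<Sum>j\<le>Suc p. Poly_Mapping.single (singular_face (Suc p) j \<sigma>) ((-1) ^ j))"
  by (simp add: fun_eq_iff kboundary_def)

lemma kboundary_add: "kboundary p (c + d) = kboundary p c + kboundary p d"
  by (simp add: kboundary_def linear_extend_add)

lemma kboundary_diff: "kboundary p (c - d) = kboundary p c - kboundary p d"
  by (simp add: kboundary_def linear_extend_diff)

lemma kboundary_scale: "kboundary p (kscale a c) = kscale a (kboundary p c)"
  by (simp add: kboundary_def linear_extend_scale)

lemma kboundary_0 [simp]: "kboundary p 0 = 0"
  by (simp add: kboundary_def)

lemma kboundary_sum: "kboundary p (sum f A) = (\<Sum>x\<in>A. kboundary p (f x))"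
  by (induction A rule: infinite_finite_induct) (auto simp: kboundary_add)

lemma kboundaries_0: "0 \<in> kboundaries p S"
  unfolding kboundaries_def using kchains_0 kboundary_0 by (metis imageI)

lemma kboundaries_add:
  "a \<in> kboundaries p S \<Longrightarrow> b \<in> kboundaries p S \<Longrightarrow> a + b \<in> kboundaries p S"
  unfolding kboundaries_def by (auto simp: kboundary_add[symmetric] intro!: imageI kchains_add)

lemma kboundaries_diff:
  "a \<in> kboundaries p S \<Longrightarrow> b \<in> kboundaries p S \<Longrightarrow> a - b \<in> kboundaries p S"
  unfolding kboundaries_def by (auto simp: kboundary_diff[symmetric] intro!: imageI kchains_diff)

lemma kboundaries_scale: "a \<in> kboundaries p S \<Longrightarrow> kscale r a \<in> kboundaries p S"
  unfolding kboundaries_def by (auto simp: kboundary_scale[symmetric] intro!: imageI kchains_scale)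

lemma kboundaries_sum: "(\<And>x. x \<in> A \<Longrightarrow> f x \<in> kboundaries p S) \<Longrightarrow> sum f A \<in> kboundaries p S"
  by (induction A rule: infinite_finite_induct) (auto intro: kboundaries_add kboundaries_0)

lemma hclass_boundary:
  assumes "b \<in> kboundaries p S"
  shows "hclass p S b = kboundaries p S"
proof -
  have "x \<in> (+) b ` kboundaries p S" if "x \<in> kboundaries p S" for x
    using kboundaries_diff[OF that assms] by (intro image_eqI[of _ _ "x - b"]) auto
  with assms show ?thesis
    by (auto simp: hclass_def intro: kboundaries_add)
qed

section \<open>Chain maps\<close>

definition kchain_map :: "nat \<Rightarrow> ('a \<Rightarrow> 'b) \<Rightarrow> ('a, 'k::field) kchain \<Rightarrow> ('b, 'k) kchain" where
  "kchain_map p g = linear_extend (\<lambda>\<sigma>. Poly_Mapping.single (simplex_map p g \<sigma>) 1)"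

lemma singular_face_simplex_map':
  assumes "j \<le> Suc p"
  shows "singular_face (Suc p) j (simplex_map (Suc p) g \<sigma>) = simplex_map p g (singular_face (Suc p) j \<sigma>)"
  using simplical_face_in_standard_simplex[of "Suc p" j] assms
  by (auto simp: singular_face_def simplex_map_def fun_eq_iff)

lemma kboundary_chain_map:
  "kboundary (Suc p) (kchain_map (Suc p) g c) = kchain_map p g (kboundary (Suc p) c)"
  unfolding kboundary_Suc kchain_map_def linear_extend_linear_extend
  by (simp add: linear_extend_sum singular_face_simplex_map' del: sum.atMost_Suc)

lemma kchain_map_in:
  assumes "c \<in> kchains p S" "continuous_map S R g"
  shows "kchain_map p g c \<in> kchains p R"
  unfolding kchain_map_def
  by (rule kchains_linear_extend[OF assms(1)])
    (auto intro!: kchains_single singular_simplex_simplex_map assms)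

lemma kchain_map_compose:
  "kchain_map p g (kchain_map p h c) = kchain_map p (g \<circ> h) c"
  by (simp add: kchain_map_def linear_extend_linear_extend simplex_map_compose)

lemma kchain_map_id_gen:
  assumes "c \<in> kchains p S" "\<And>x. x \<in> topspace S \<Longrightarrow> g x = x"
  shows "kchain_map p g c = c"
proof -
  have "kchain_map p g c = linear_extend (\<lambda>\<sigma>. Poly_Mapping.single \<sigma> 1) c"
    unfolding kchain_map_def using assms
    by (intro linear_extend_cong) (auto simp: kchains_def simplex_map_id_gen)
  then show ?thesis by (simp add: linear_extend_id)
qed

lemma kchain_map_add: "kchain_map p g (c + d) = kchain_map p g c + kchain_map p g d"
  by (simp add: kchain_map_def linear_extend_add)

lemma kchain_map_scale: "kchain_map p g (kscale a c) = kscale a (kchain_map p g c)"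
  by (simp add: kchain_map_def linear_extend_scale)

lemma kchain_map_sum: "kchain_map p g (sum f A) = (\<Sum>x\<in>A. kchain_map p g (f x))"
  by (simp add: kchain_map_def linear_extend_sum)

section \<open>The prism operator\<close>

lemma singular_simplex_top_of_set:
  "singular_simplex p (top_of_set S) \<sigma> \<longleftrightarrow>
     continuous_on (standard_simplex p) \<sigma> \<and> \<sigma> \<in> standard_simplex p \<rightarrow> S \<and>
     \<sigma> \<in> extensional (standard_simplex p)"
  by (auto simp: singular_simplex_def euclidean_product_topology continuous_map_in_subtopology)

text \<open>The affine map from the \<open>(p + 1)\<close>-simplex to the \<open>p\<close>-simplex that identifies the
  vertices \<open>j\<close> and \<open>j + 1\<close>, in barycentric coordinates.\<close>

definition degeneracy :: "nat \<Rightarrow> (nat \<Rightarrow> real) \<Rightarrow> nat \<Rightarrow> real" where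
  "degeneracy j y = (\<lambda>a. if a < j then y a else if a = j then y j + y (Suc j) else y (Suc a))"

text \<open>With \<open>v\<^sub>a\<close> and \<open>w\<^sub>a\<close> the vertices at the bottom and at the top of the prism over a
  \<open>p\<close>-simplex, this is the image of \<open>[v\<^sub>0, \<dots>, v\<^sub>j, w\<^sub>j, \<dots>, w\<^sub>p]\<close>: the height of a point is the
  total weight of the vertices \<open>w\<close>, that is, of the coordinates after the \<open>j\<close>-th.\<close>

definition prism_simplex ::
    "nat \<Rightarrow> (real \<Rightarrow> 'a \<Rightarrow> 'b) \<Rightarrow> nat \<Rightarrow> ((nat \<Rightarrow> real) \<Rightarrow> 'a) \<Rightarrow> (nat \<Rightarrow> real) \<Rightarrow> 'b" where
  "prism_simplex p H j \<sigma> =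
     restrict (\<lambda>y. H (\<Sum>a=Suc j..Suc p. y a) (\<sigma> (degeneracy j y))) (standard_simplex (Suc p))"

definition prism :: "nat \<Rightarrow> (real \<Rightarrow> 'a \<Rightarrow> 'b) \<Rightarrow> ('a, 'k::field) kchain \<Rightarrow> ('b, 'k) kchain" where
  "prism p H = linear_extend (\<lambda>\<sigma>. \<Sum>j\<le>p. Poly_Mapping.single (prism_simplex p H j \<sigma>) ((-1) ^ j))"

text \<open>The wall \<open>[v\<^sub>0, \<dots>, v\<^bsub>j - 1\<^esub>, w\<^sub>j, \<dots>, w\<^sub>p]\<close> that two consecutive simplices of the prism share;
  for \<open>j = 0\<close> it is the top of the prism and for \<open>j = p + 1\<close> the bottom.\<close>

definition mid_simplex ::
    "nat \<Rightarrow> (real \<Rightarrow> 'a \<Rightarrow> 'b) \<Rightarrow> nat \<Rightarrow> ((nat \<Rightarrow> real) \<Rightarrow> 'a) \<Rightarrow> (nat \<Rightarrow> real) \<Rightarrow> 'b" where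
  "mid_simplex p H j \<sigma> = restrict (\<lambda>y. H (\<Sum>a=j..p. y a) (\<sigma> y)) (standard_simplex p)"

lemma sum_degeneracy: "j \<le> p \<Longrightarrow> (\<Sum>a\<le>p. degeneracy j y a) = (\<Sum>a\<le>Suc p. y a)"
proof (induction p)
  case (Suc p)
  show ?case
  proof (cases "j = Suc p")
    case True
    have "(\<Sum>a\<le>p. degeneracy (Suc p) y a) = (\<Sum>a\<le>p. y a)"
      by (rule sum.cong) (auto simp: degeneracy_def)
    with True show ?thesis by (simp add: degeneracy_def add_ac)
  next
    case False
    with Suc show ?thesis by (simp add: degeneracy_def)
  qed
qed (simp add: degeneracy_def)

lemma degeneracy_in_standard_simplex:
  assumes "j \<le> p" "y \<in> standard_simplex (Suc p)"
  shows "degeneracy j y \<in> standard_simplex p"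
proof -
  have y: "\<And>i. 0 \<le> y i" "\<And>i. y i \<le> 1" "\<And>i. i > Suc p \<Longrightarrow> y i = 0" "(\<Sum>i\<le>Suc p. y i) = 1"
    using assms(2) by (auto simp: standard_simplex_def)
  have "y j + y (Suc j) = (\<Sum>i\<in>{j, Suc j}. y i)" by simp
  also have "\<dots> \<le> (\<Sum>i\<le>Suc p. y i)"
    using assms(1) y(1) by (intro sum_mono2) auto
  finally have "y j + y (Suc j) \<le> 1" using y(4) by simp
  moreover have "(\<Sum>a\<le>p. degeneracy j y a) = 1"
    using sum_degeneracy[OF assms(1), of y] y(4) by simp
  ultimately show ?thesis
    using y(1-3) assms(1) by (auto simp: standard_simplex_def degeneracy_def)
qed

text \<open>Inserting a zero among the summed coordinates does not change their sum, inserting it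
  earlier shifts the range of summation. These two facts describe the height function of a
  prism simplex on its faces.\<close>

lemma tail_face_le: "k \<le> b \<Longrightarrow> b \<le> Suc p \<Longrightarrow>
   (\<Sum>a=k..Suc p. simplical_face b y a) = (\<Sum>a=k..p. y a)" for y :: "nat \<Rightarrow> real"
proof (induction p)
  case 0
  then consider "b = 0" "k = 0" | "b = 1" "k = 0" | "b = 1" "k = 1" by linarith
  then show ?case by cases (auto simp: simplical_face_def)
next
  case (Suc p)
  show ?case
  proof (cases "b = Suc (Suc p)")
    case True
    have "(\<Sum>a=k..Suc p. simplical_face b y a) = (\<Sum>a=k..Suc p. y a)"
      by (rule sum.cong) (auto simp: simplical_face_def True)
    then show ?thesis using Suc.prems True by (simp add: simplical_face_def)
  next
    case False
    with Suc.IH Suc.prems show ?thesis by (simp add: simplical_face_def)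
  qed
qed

lemma tail_face_gt: "b \<le> k \<Longrightarrow>
   (\<Sum>a=Suc k..Suc p. simplical_face b y a) = (\<Sum>a=k..p. y a)" for y :: "nat \<Rightarrow> real"
  unfolding sum.shift_bounds_cl_Suc_ivl by (rule sum.cong) (auto simp: simplical_face_def)

lemma degeneracy_face_less:
  "b \<le> j \<Longrightarrow> degeneracy (Suc j) (simplical_face b y) = simplical_face b (degeneracy j y)"
  by (auto simp: degeneracy_def simplical_face_def fun_eq_iff)

lemma degeneracy_face_eq:
  "degeneracy j (simplical_face j y) = y" "degeneracy j (simplical_face (Suc j) y) = y"
  by (auto simp: degeneracy_def simplical_face_def fun_eq_iff)

lemma degeneracy_face_greater:
  "j < b \<Longrightarrow> degeneracy j (simplical_face (Suc b) y) = simplical_face b (degeneracy j y)"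
  by (auto simp: degeneracy_def simplical_face_def fun_eq_iff Suc_diff_Suc)

lemma restrict_eqI: "(\<And>x. x \<in> A \<Longrightarrow> f x = g x) \<Longrightarrow> restrict f A = restrict g A"
  by auto

lemma singular_face_Suc:
  "singular_face (Suc p) b f = restrict (f \<circ> simplical_face b) (standard_simplex p)"
  by (simp add: singular_face_def)

lemma tail_in_unit_interval:
  assumes "y \<in> standard_simplex p" shows "(\<Sum>a=k..p. y a) \<in> {0..1}"
proof -
  have "(\<Sum>a=k..p. y a) \<le> (\<Sum>a\<le>p. y a)"
    using assms by (intro sum_mono2) (auto simp: standard_simplex_def)
  moreover have "0 \<le> (\<Sum>a=k..p. y a)"
    using assms by (intro sum_nonneg) (auto simp: standard_simplex_def)
  ultimately show ?thesis using assms by (auto simp: standard_simplex_def)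
qed

lemma face_prism_less:
  assumes "b \<le> j" "j \<le> p"
  shows "singular_face (Suc (Suc p)) b (prism_simplex (Suc p) H (Suc j) \<sigma>)
       = prism_simplex p H j (singular_face (Suc p) b \<sigma>)"
  unfolding singular_face_Suc prism_simplex_def
proof (intro restrict_eqI)
  fix y :: "nat \<Rightarrow> real" assume y: "y \<in> standard_simplex (Suc p)"
  then have "simplical_face b y \<in> standard_simplex (Suc (Suc p))"
    using assms simplical_face_in_standard_simplex[of "Suc (Suc p)" b y] by simp
  moreover have "degeneracy j y \<in> standard_simplex p"
    using assms y by (intro degeneracy_in_standard_simplex) auto
  moreover have "(\<Sum>a = Suc (Suc j)..Suc (Suc p). simplical_face b y a) = (\<Sum>a = Suc j..Suc p. y a)"
    using assms by (intro tail_face_gt) auto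
  ultimately show "(restrict (\<lambda>y. H (\<Sum>a = Suc (Suc j)..Suc (Suc p). y a) (\<sigma> (degeneracy (Suc j) y)))
          (standard_simplex (Suc (Suc p))) \<circ> simplical_face b) y =
         H (\<Sum>a = Suc j..Suc p. y a) (restrict (\<sigma> \<circ> simplical_face b) (standard_simplex p) (degeneracy j y))"
    using assms by (simp add: degeneracy_face_less del: sum.cl_ivl_Suc)
qed

lemma face_prism_greater:
  assumes "j < b" "b \<le> Suc p"
  shows "singular_face (Suc (Suc p)) (Suc b) (prism_simplex (Suc p) H j \<sigma>)
       = prism_simplex p H j (singular_face (Suc p) b \<sigma>)"
  unfolding singular_face_Suc prism_simplex_def
proof (intro restrict_eqI)
  fix y :: "nat \<Rightarrow> real" assume y: "y \<in> standard_simplex (Suc p)"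
  then have "simplical_face (Suc b) y \<in> standard_simplex (Suc (Suc p))"
    using assms simplical_face_in_standard_simplex[of "Suc (Suc p)" "Suc b" y] by simp
  moreover have "degeneracy j y \<in> standard_simplex p"
    using assms y by (intro degeneracy_in_standard_simplex) auto
  moreover have "(\<Sum>a = Suc j..Suc (Suc p). simplical_face (Suc b) y a) = (\<Sum>a = Suc j..Suc p. y a)"
    using assms by (intro tail_face_le) auto
  ultimately show "(restrict (\<lambda>y. H (\<Sum>a = Suc j..Suc (Suc p). y a) (\<sigma> (degeneracy j y)))
          (standard_simplex (Suc (Suc p))) \<circ> simplical_face (Suc b)) y =
         H (\<Sum>a = Suc j..Suc p. y a) (restrict (\<sigma> \<circ> simplical_face b) (standard_simplex p) (degeneracy j y))"
    using assms by (simp add: degeneracy_face_greater del: sum.cl_ivl_Suc)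
qed

lemma face_prism_mid:
  assumes "j \<le> p"
  shows "singular_face (Suc p) j (prism_simplex p H j \<sigma>) = mid_simplex p H j \<sigma>"
    and "singular_face (Suc p) (Suc j) (prism_simplex p H j \<sigma>) = mid_simplex p H (Suc j) \<sigma>"
proof -
  have face: "simplical_face b y \<in> standard_simplex (Suc p)"
    if "b \<le> Suc p" "y \<in> standard_simplex p" for b and y :: "nat \<Rightarrow> real"
    using that simplical_face_in_standard_simplex[of "Suc p" b y] by simp
  show "singular_face (Suc p) j (prism_simplex p H j \<sigma>) = mid_simplex p H j \<sigma>"
    unfolding singular_face_Suc prism_simplex_def mid_simplex_def using assms
    by (intro restrict_eqI)
      (simp add: face degeneracy_face_eq tail_face_gt tail_face_gt[of j j, simplified] del: sum.cl_ivl_Suc)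
  show "singular_face (Suc p) (Suc j) (prism_simplex p H j \<sigma>) = mid_simplex p H (Suc j) \<sigma>"
    unfolding singular_face_Suc prism_simplex_def mid_simplex_def using assms
    by (intro restrict_eqI)
      (simp add: face degeneracy_face_eq tail_face_le del: sum.cl_ivl_Suc)
qed

lemma mid_simplex_ends:
  "mid_simplex p H 0 \<sigma> = simplex_map p (H 1) \<sigma>" "mid_simplex p H (Suc p) \<sigma> = simplex_map p (H 0) \<sigma>"
  unfolding mid_simplex_def simplex_map_def
  by (auto intro!: restrict_eqI simp: standard_simplex_def atMost_atLeast0)

text \<open>Of the faces of the \<open>j\<close>-th prism simplex, those numbered \<open>j\<close> and \<open>j + 1\<close> are walls, which
  cancel between neighbouring values of \<open>j\<close> up to the top and the bottom. The other faces
  omit a vertex of the base simplex and make up the prism over its boundary; one of the two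
  indices drops by one in the process, which gives the minus sign.\<close>

lemma kboundary_prism_single:
  fixes \<sigma> :: "(nat \<Rightarrow> real) \<Rightarrow> 'a" and H :: "real \<Rightarrow> 'a \<Rightarrow> 'b"
  defines "s n x \<equiv> Poly_Mapping.single x ((-1) ^ n) :: ('b, 'k::field) kchain"
  shows "(\<Sum>j\<le>p. \<Sum>b\<le>Suc p. s (j + b) (singular_face (Suc p) b (prism_simplex p H j \<sigma>))) =
     Poly_Mapping.single (simplex_map p (H 1) \<sigma>) 1 - Poly_Mapping.single (simplex_map p (H 0) \<sigma>) 1
     - (if p = 0 then 0 else \<Sum>b\<le>p. \<Sum>j\<le>p - 1. s (b + j) (prism_simplex (p - 1) H j (singular_face p b \<sigma>)))"
proof -
  define F where "F j b = s (j + b) (singular_face (Suc p) b (prism_simplex p H j \<sigma>))" for j b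
  have s_Suc: "s (Suc n) x = - s n x" for n x
    by (simp add: s_def single_uminus)
  have s_even: "s (n + n) x = Poly_Mapping.single x 1" for n x
    by (simp add: s_def)
  have split: "(\<Sum>b\<le>Suc p. F j b) = (F j j + F j (Suc j)) + ((\<Sum>b<j. F j b) + (\<Sum>b=Suc j..p. F j (Suc b)))"
    if "j \<le> p" for j
  proof -
    have "{..Suc p} = {..<j} \<union> {j, Suc j} \<union> {Suc (Suc j)..Suc p}" using that by auto
    then have "(\<Sum>b\<le>Suc p. F j b) = (\<Sum>b\<in>{..<j} \<union> {j, Suc j} \<union> {Suc (Suc j)..Suc p}. F j b)" by (simp only:)
    also have "\<dots> = (\<Sum>b<j. F j b) + (F j j + F j (Suc j)) + (\<Sum>b=Suc (Suc j)..Suc p. F j b)"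
      by (subst sum.union_disjoint, auto)+
    finally show ?thesis
      by (simp only: sum.shift_bounds_cl_Suc_ivl add_ac)
  qed
  have mid: "(\<Sum>j\<le>p. F j j + F j (Suc j)) =
      Poly_Mapping.single (simplex_map p (H 1) \<sigma>) 1 - Poly_Mapping.single (simplex_map p (H 0) \<sigma>) 1"
  proof -
    define Q where "Q j = (Poly_Mapping.single (mid_simplex p H j \<sigma>) 1 :: ('b, 'k) kchain)" for j
    have "(\<Sum>j\<le>p. F j j + F j (Suc j)) = (\<Sum>j\<le>p. Q j - Q (Suc j))"
      by (rule sum.cong) (auto simp: F_def face_prism_mid s_Suc s_even Q_def)
    also have "\<dots> = Q 0 - Q (Suc p)"
      by (rule sum_telescope)
    finally show ?thesis by (simp add: Q_def mid_simplex_ends)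
  qed
  have off: "(\<Sum>j\<le>p. (\<Sum>b<j. F j b) + (\<Sum>b=Suc j..p. F j (Suc b))) =
     - (if p = 0 then 0 else \<Sum>b\<le>p. \<Sum>j\<le>p - 1. s (b + j) (prism_simplex (p - 1) H j (singular_face p b \<sigma>)))"
  proof (cases p)
    case (Suc q)
    define G where "G j b = s (j + b) (prism_simplex q H j (singular_face p b \<sigma>))" for j b
    have "(\<Sum>j\<le>p. \<Sum>b<j. F j b) = (\<Sum>j\<le>q. \<Sum>b<Suc j. F (Suc j) b)"
      unfolding Suc by (subst sum.atMost_Suc_shift) simp
    also have "\<dots> = (\<Sum>j\<le>q. \<Sum>b\<in>{..j}. - G j b)"
      by (intro sum.cong) (auto simp: F_def G_def Suc face_prism_less s_Suc)
    finally have 1: "(\<Sum>j\<le>p. \<Sum>b<j. F j b) = (\<Sum>j\<le>q. \<Sum>b\<in>{..j}. - G j b)" .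
    have "(\<Sum>j\<le>p. \<Sum>b=Suc j..p. F j (Suc b)) = (\<Sum>j\<le>q. \<Sum>b=Suc j..p. F j (Suc b))"
      unfolding Suc by simp
    also have "\<dots> = (\<Sum>j\<le>q. \<Sum>b=Suc j..p. - G j b)"
      by (intro sum.cong) (auto simp: F_def G_def Suc face_prism_greater s_Suc)
    finally have 2: "(\<Sum>j\<le>p. \<Sum>b=Suc j..p. F j (Suc b)) = (\<Sum>j\<le>q. \<Sum>b=Suc j..p. - G j b)" .
    have "(\<Sum>b\<in>{..j}. - G j b) + (\<Sum>b=Suc j..p. - G j b) = (\<Sum>b\<le>p. - G j b)" if "j \<le> q" for j
      using that Suc
      by (subst sum.union_disjoint[symmetric]) (auto intro!: sum.cong simp del: sum.atMost_Suc)
    then have "(\<Sum>j\<le>p. (\<Sum>b<j. F j b) + (\<Sum>b=Suc j..p. F j (Suc b))) = (\<Sum>j\<le>q. \<Sum>b\<le>p. - G j b)"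
      unfolding sum.distrib 1 2 unfolding sum.distrib[symmetric] by (intro sum.cong) auto
    also have "\<dots> = - (\<Sum>b\<le>p. \<Sum>j\<le>q. G j b)"
      by (subst sum.swap) (simp add: sum_negf)
    finally show ?thesis
      by (simp add: Suc G_def add.commute del: sum.atMost_Suc)
  qed auto
  have "(\<Sum>j\<le>p. \<Sum>b\<le>Suc p. F j b) = (\<Sum>j\<le>p. F j j + F j (Suc j)) +
      (\<Sum>j\<le>p. (\<Sum>b<j. F j b) + (\<Sum>b=Suc j..p. F j (Suc b)))"
    by (simp add: split sum.distrib del: sum.atMost_Suc)
  then show ?thesis
    unfolding mid off by (simp add: F_def del: sum.atMost_Suc)
qed

lemma kboundary_prism:
  "kboundary (Suc p) (prism p H c) =
     kchain_map p (H 1) c - kchain_map p (H 0) c - prism (p - 1) H (kboundary p c)"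
proof -
  have "kboundary (Suc p) (prism p H c) =
     linear_extend (\<lambda>\<sigma>. \<Sum>j\<le>p. \<Sum>b\<le>Suc p.
       Poly_Mapping.single (singular_face (Suc p) b (prism_simplex p H j \<sigma>)) ((-1) ^ (j + b))) c"
    unfolding kboundary_Suc prism_def linear_extend_linear_extend
    by (simp add: linear_extend_sum kscale_sum power_add del: sum.atMost_Suc)
  also have "\<dots> = kchain_map p (H 1) c - kchain_map p (H 0) c - linear_extend (\<lambda>\<sigma>. if p = 0 then 0 else
      \<Sum>b\<le>p. \<Sum>j\<le>p - 1. Poly_Mapping.single (prism_simplex (p - 1) H j (singular_face p b \<sigma>)) ((-1) ^ (b + j))) c"
    unfolding kboundary_prism_single linear_extend_minus kchain_map_def ..
  also have "linear_extend (\<lambda>\<sigma>. if p = 0 then 0 else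
      \<Sum>b\<le>p. \<Sum>j\<le>p - 1. Poly_Mapping.single (prism_simplex (p - 1) H j (singular_face p b \<sigma>)) ((-1) ^ (b + j))) c
      = prism (p - 1) H (kboundary p c)"
    unfolding kboundary_def prism_def
    by (cases p)
      (auto simp: linear_extend_linear_extend linear_extend_sum kscale_sum power_add linear_extend_def[of "\<lambda>_. 0"]
        kscale_def[symmetric] simp del: sum.atMost_Suc)
  finally show ?thesis .
qed

lemma singular_simplex_prism:
  assumes \<sigma>: "singular_simplex p (top_of_set S) \<sigma>" and "j \<le> p"
    and H: "continuous_on ({0..1} \<times> S) (\<lambda>(t, x). H t x)"
    and into: "\<And>t x. t \<in> {0..1} \<Longrightarrow> x \<in> S \<Longrightarrow> H t x \<in> T"
  shows "singular_simplex (Suc p) (top_of_set T) (prism_simplex p H j \<sigma>)"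
proof -
  let ?D = "standard_simplex (Suc p)"
  have \<sigma>': "continuous_on (standard_simplex p) \<sigma>" "\<And>y. y \<in> standard_simplex p \<Longrightarrow> \<sigma> y \<in> S"
    using \<sigma> by (auto simp: singular_simplex_top_of_set)
  have tail: "(\<Sum>a=Suc j..Suc p. y a) \<in> {0..1}" if "y \<in> ?D" for y
    using that by (rule tail_in_unit_interval)
  have deg: "degeneracy j y \<in> standard_simplex p" if "y \<in> ?D" for y
    using that assms(2) by (intro degeneracy_in_standard_simplex)
  have coord: "continuous_on A (\<lambda>y::nat \<Rightarrow> real. y i)" for A i
    by (rule continuous_on_subset[OF continuous_on_product_coordinates]) auto
  have "continuous_on ?D (\<lambda>y. \<sigma> (degeneracy j y))"
  proof (rule continuous_on_compose2[OF \<sigma>'(1)])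
    show "continuous_on ?D (degeneracy j)"
    proof (rule continuous_on_coordinatewise_then_product)
      fix a show "continuous_on ?D (\<lambda>x. degeneracy j x a)"
        by (cases "a < j"; cases "a = j")
          (auto simp: degeneracy_def intro!: continuous_on_add coord)
    qed
  qed (use deg in auto)
  moreover have "continuous_on ?D (\<lambda>y. \<Sum>a=Suc j..Suc p. y a)"
    by (intro continuous_intros coord)
  ultimately have "continuous_on ?D (\<lambda>y. (\<Sum>a=Suc j..Suc p. y a, \<sigma> (degeneracy j y)))"
    by (intro continuous_on_Pair)
  then have "continuous_on ?D (\<lambda>y. case (\<Sum>a=Suc j..Suc p. y a, \<sigma> (degeneracy j y)) of (t, x) \<Rightarrow> H t x)"
    by (rule continuous_on_compose2[OF H]) (use tail deg \<sigma>'(2) in blast)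
  then have "continuous_on ?D (\<lambda>y. H (\<Sum>a=Suc j..Suc p. y a) (\<sigma> (degeneracy j y)))"
    by (simp only: prod.case)
  then have "continuous_on ?D (prism_simplex p H j \<sigma>)"
    by (subst continuous_on_cong[OF refl, of _ _ "\<lambda>y. H (\<Sum>a=Suc j..Suc p. y a) (\<sigma> (degeneracy j y))"])
      (simp_all add: prism_simplex_def)
  then show ?thesis
    using tail deg \<sigma>'(2) into by (auto simp: singular_simplex_top_of_set prism_simplex_def simp del: sum.cl_ivl_Suc)
qed

lemma prism_in_kchains:
  assumes c: "c \<in> kchains p (top_of_set S)"
    and H: "continuous_on ({0..1} \<times> S) (\<lambda>(t, x). H t x)"
    and into: "\<And>t x. t \<in> {0..1} \<Longrightarrow> x \<in> S \<Longrightarrow> H t x \<in> T"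
  shows "prism p H c \<in> kchains (Suc p) (top_of_set T)"
  unfolding prism_def
  by (rule kchains_linear_extend[OF c], intro kchains_sum kchains_single)
    (auto intro: singular_simplex_prism[OF _ _ H into])

text \<open>Used for deck transformations, which commute with the rotations of the coordinates.\<close>

lemma kchain_map_prism:
  assumes c: "c \<in> kchains p (top_of_set S)"
    and comm: "\<And>t x. t \<in> {0..1} \<Longrightarrow> x \<in> S \<Longrightarrow> g (H t x) = H t (g x)"
  shows "kchain_map (Suc p) g (prism p H c) = prism p H (kchain_map p g c)"
proof -
  have "simplex_map (Suc p) g (prism_simplex p H j \<sigma>) = prism_simplex p H j (simplex_map p g \<sigma>)"
    if \<sigma>: "singular_simplex p (top_of_set S) \<sigma>" and j: "j \<le> p" for j \<sigma>
    unfolding prism_simplex_def simplex_map_def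
  proof (intro restrict_eqI)
    fix y :: "nat \<Rightarrow> real" assume y: "y \<in> standard_simplex (Suc p)"
    have "(\<Sum>a=Suc j..Suc p. y a) \<in> {0..1}" using y by (rule tail_in_unit_interval)
    moreover have "degeneracy j y \<in> standard_simplex p"
      using y j by (intro degeneracy_in_standard_simplex)
    moreover from this have "\<sigma> (degeneracy j y) \<in> S"
      using \<sigma> by (auto simp: singular_simplex_top_of_set)
    ultimately show "(g \<circ> (\<lambda>y\<in>standard_simplex (Suc p). H (\<Sum>a = Suc j..Suc p. y a) (\<sigma> (degeneracy j y)))) y =
         H (\<Sum>a = Suc j..Suc p. y a) (restrict (g \<circ> \<sigma>) (standard_simplex p) (degeneracy j y))"
      using y by (simp add: comm del: sum.cl_ivl_Suc)
  qed
  then show ?thesis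
    unfolding prism_def kchain_map_def linear_extend_linear_extend using c
    by (intro linear_extend_cong) (auto simp: linear_extend_sum kchains_def)
qed

section \<open>Cup products of classes pulled back from the circle\<close>

lemma cis_2pi_eq_iff: "cis (2 * pi * a) = cis (2 * pi * b) \<longleftrightarrow> a - b \<in> \<int>"
proof
  assume "cis (2 * pi * a) = cis (2 * pi * b)"
  then have "cis (2 * pi * (a - b)) = 1"
    unfolding right_diff_distrib cis_divide[symmetric] by simp
  then have "cos (2 * pi * (a - b)) = 1"
    by (simp only: complex_eq_iff cis.sel one_complex.sel)
  then obtain n :: int where "2 * pi * (a - b) = n * 2 * pi"
    using cos_one_2pi_int by auto
  then have "(2 * pi) * (a - b) = (2 * pi) * n"
    by (simp add: mult_ac)
  then have "a - b = n"
    by (subst (asm) mult_cancel_left) auto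
  then show "a - b \<in> \<int>" by simp
next
  assume "a - b \<in> \<int>"
  then obtain n :: int where "a = b + n"
    by (metis Ints_cases add.commute diff_add_cancel)
  then have "2 * pi * a = 2 * pi * b + 2 * pi * n"
    by (simp add: distrib_left)
  then have "cis (2 * pi * a) = cis (2 * pi * b) * cis (2 * pi * n)"
    by (simp only: cis_mult)
  then show "cis (2 * pi * a) = cis (2 * pi * b)" by simp
qed

definition circle_lift :: "(real \<Rightarrow> complex) \<Rightarrow> (real \<Rightarrow> real) \<Rightarrow> bool" where
  "circle_lift h \<theta> \<longleftrightarrow> continuous_on {0..1} \<theta> \<and> (\<forall>u\<in>{0..1}. h u = cis (2 * pi * \<theta> u))"

text \<open>The endpoints of a path in the circle are compared by means of the branch of the argument in
  \<open>(- \<pi>, \<pi>]\<close>. Subtracting its variation from that of a lift leaves an integer even for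
  paths that are not closed; thus the values are defined in every ring, and \<open>turns\<close> is a
  cocycle in the class of the identity map of the circle.\<close>

definition turns :: "(real \<Rightarrow> complex) \<Rightarrow> int" where
  "turns h = (THE n. \<exists>\<theta>. circle_lift h \<theta> \<and>
     \<theta> 1 - \<theta> 0 = Arg (h 1) / (2 * pi) - Arg (h 0) / (2 * pi) + of_int n)"

text \<open>Two lifts differ by a continuous integer-valued function, which is constant.\<close>

lemma circle_lift_unique:
  assumes "circle_lift h \<theta>" "circle_lift h \<theta>'"
  shows "\<theta> 1 - \<theta> 0 = \<theta>' 1 - \<theta>' 0"
proof -
  let ?d = "\<lambda>u. \<theta> u - \<theta>' u"
  have int: "?d u \<in> \<int>" if "u \<in> {0..1}" for u
    using assms that by (simp add: circle_lift_def flip: cis_2pi_eq_iff)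
  have "?d constant_on {0..1}"
  proof (rule continuous_discrete_range_constant)
    show "continuous_on {0..1} ?d"
      using assms by (intro continuous_intros) (auto simp: circle_lift_def)
    fix x :: real assume x: "x \<in> {0..1}"
    have "1 \<le> norm (?d y - ?d x)" if "y \<in> {0..1}" "?d y \<noteq> ?d x" for y
    proof -
      have "?d y - ?d x \<in> \<int>" using int[OF x] int[OF that(1)] by (rule Ints_diff[rotated])
      with that show ?thesis using Ints_nonzero_abs_ge1[of "?d y - ?d x"] by simp
    qed
    then show "\<exists>e>0. \<forall>y. y \<in> {0..1} \<and> ?d y \<noteq> ?d x \<longrightarrow> e \<le> norm (?d y - ?d x)"
      by (intro exI[of _ 1]) auto
  qed auto
  then obtain c where "\<And>u. u \<in> {0..1} \<Longrightarrow> ?d u = c"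
    by (auto simp: constant_on_def)
  from this[of 0] this[of 1] show ?thesis by simp
qed

lemma turns_eqI:
  assumes "circle_lift h \<theta>"
    and "\<theta> 1 - \<theta> 0 = Arg (h 1) / (2 * pi) - Arg (h 0) / (2 * pi) + of_int n"
  shows "turns h = n"
  unfolding turns_def
proof (rule the_equality)
  show "\<exists>\<theta>. circle_lift h \<theta> \<and> \<theta> 1 - \<theta> 0 = Arg (h 1) / (2 * pi) - Arg (h 0) / (2 * pi) + of_int n"
    using assms by blast
next
  fix n' assume "\<exists>\<theta>. circle_lift h \<theta> \<and>
     \<theta> 1 - \<theta> 0 = Arg (h 1) / (2 * pi) - Arg (h 0) / (2 * pi) + of_int n'"
  with circle_lift_unique[OF assms(1)] assms(2) show "n' = n" by force
qed

lemma turns_loop: "(\<And>u. u \<in> {0..1} \<Longrightarrow> h u = cis (2 * pi * u)) \<Longrightarrow> turns h = 1"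
  by (rule turns_eqI[of h "\<lambda>u. u"]) (auto simp: circle_lift_def)

lemma turns_const: "(\<And>u. u \<in> {0..1} \<Longrightarrow> h u = 1) \<Longrightarrow> turns h = 0"
  by (rule turns_eqI[of h "\<lambda>u. 0"]) (auto simp: circle_lift_def)

text \<open>A triangle is contractible, so the map lifts to the line on all of it. The lift and the branch
  of the argument differ by an integer \<open>N\<close> at each vertex, the number of turns along an edge
  is the difference of \<open>N\<close> at its ends, and these differences add up to zero.\<close>

lemma turns_triangle:
  fixes F :: "real \<times> real \<Rightarrow> complex"
  defines "T \<equiv> {(a, b). 0 \<le> a \<and> 0 \<le> b \<and> a + b \<le> 1}"
  assumes cont: "continuous_on T F" and unit: "\<And>p. p \<in> T \<Longrightarrow> norm (F p) = 1"
  shows "turns (\<lambda>u. F (1 - u, u)) - turns (\<lambda>u. F (0, u)) + turns (\<lambda>u. F (u, 0)) = 0"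
proof -
  have "convex T"
  proof -
    have "T = {p. 0 \<le> inner (1, 0) p} \<inter> {p. 0 \<le> inner (0, 1) p} \<inter> {p. inner (1, 1) p \<le> 1}"
      by (auto simp: T_def)
    moreover have "{p. 0 \<le> inner (q :: real \<times> real) p} = {p. inner q p \<ge> 0}" for q by simp
    ultimately show ?thesis
      by (simp only: convex_Int convex_halfspace_ge convex_halfspace_le)
  qed
  then obtain G where G: "continuous_on T G" "\<And>p. p \<in> T \<Longrightarrow> F p = exp (G p)"
    using continuous_logarithm_on_contractible[OF cont convex_imp_contractible] unit
    by (metis norm_zero zero_neq_one)
  define \<Theta> where "\<Theta> p = Im (G p) / (2 * pi)" for p
  have \<Theta>: "continuous_on T \<Theta>"
    unfolding \<Theta>_def by (intro continuous_intros G) auto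
  have F: "F p = cis (2 * pi * \<Theta> p)" if "p \<in> T" for p
  proof -
    have "exp (Re (G p)) = 1"
      using unit[OF that] G(2)[OF that] by (metis norm_exp_eq_Re)
    then show ?thesis using G(2)[OF that] by (simp add: \<Theta>_def exp_eq_polar)
  qed
  have "\<exists>n::int. \<Theta> p - Arg (F p) / (2 * pi) = of_int n" if "p \<in> T" for p
  proof -
    have "cis (2 * pi * (Arg (F p) / (2 * pi))) = F p"
      using rcis_cmod_Arg[of "F p"] unit[OF that] by (simp add: rcis_def)
    then have "\<Theta> p - Arg (F p) / (2 * pi) \<in> \<int>"
      using F[OF that] cis_2pi_eq_iff by metis
    then show ?thesis by (auto elim: Ints_cases)
  qed
  then obtain N :: "real \<times> real \<Rightarrow> int"
    where N: "\<And>p. p \<in> T \<Longrightarrow> \<Theta> p - Arg (F p) / (2 * pi) = of_int (N p)"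
    by metis
  have edge: "turns (\<lambda>u. F (\<gamma> u)) = N (\<gamma> 1) - N (\<gamma> 0)"
    if "continuous_on {0..1} \<gamma>" "\<And>u. u \<in> {0..1} \<Longrightarrow> \<gamma> u \<in> T" for \<gamma>
  proof (rule turns_eqI[of _ "\<lambda>u. \<Theta> (\<gamma> u)"])
    show "circle_lift (\<lambda>u. F (\<gamma> u)) (\<lambda>u. \<Theta> (\<gamma> u))"
      unfolding circle_lift_def using that F
      by (auto intro!: continuous_on_compose2[OF \<Theta>])
    show "\<Theta> (\<gamma> 1) - \<Theta> (\<gamma> 0) =
       Arg (F (\<gamma> 1)) / (2 * pi) - Arg (F (\<gamma> 0)) / (2 * pi) + of_int (N (\<gamma> 1) - N (\<gamma> 0))"
      using N[OF that(2), of 1] N[OF that(2), of 0] by simp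
  qed
  have "turns (\<lambda>u. F (1 - u, u)) = N (0, 1) - N (1, 0)"
    by (subst edge) (auto simp: T_def intro!: continuous_intros)
  moreover have "turns (\<lambda>u. F (0, u)) = N (0, 1) - N (0, 0)"
    by (subst edge) (auto simp: T_def intro!: continuous_intros)
  moreover have "turns (\<lambda>u. F (u, 0)) = N (1, 0) - N (0, 0)"
    by (subst edge) (auto simp: T_def intro!: continuous_intros)
  ultimately show ?thesis by simp
qed

definition first_edge :: "real \<Rightarrow> nat \<Rightarrow> real" where
  "first_edge u = (\<lambda>a. if a = 0 then 1 - u else if a = 1 then u else 0)"

text \<open>The Alexander--Whitney formula for the cup product of the degree-one cocycles of the maps in
  the list: each map is evaluated on the first edge, and the back face, which omits the
  vertex \<open>0\<close>, is passed on to the rest.\<close>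

primrec cup :: "('a \<Rightarrow> complex) list \<Rightarrow> ((nat \<Rightarrow> real) \<Rightarrow> 'a) \<Rightarrow> 'k::comm_ring_1" where
  "cup [] \<sigma> = 1"
| "cup (g # gs) \<sigma> =
     of_int (turns (\<lambda>u. g (\<sigma> (first_edge u)))) * cup gs (singular_face (Suc (length gs)) 0 \<sigma>)"

lemma first_edge_in_standard_simplex: "u \<in> {0..1} \<Longrightarrow> first_edge u \<in> standard_simplex (Suc p)"
  by (auto simp: standard_simplex_def first_edge_def sum.atMost_Suc_shift simp del: sum.atMost_Suc)

lemma turns_cong: "(\<And>u. u \<in> {0..1} \<Longrightarrow> h u = h' u) \<Longrightarrow> turns h = turns h'"
  by (simp add: turns_def circle_lift_def)

lemma singular_face_first_edge:
  "u \<in> {0..1} \<Longrightarrow>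
     singular_face (Suc (Suc p)) j \<tau> (first_edge u) = \<tau> (simplical_face j (first_edge u))"
  by (simp add: singular_face_Suc first_edge_in_standard_simplex)

lemma turns_simplex_triangle:
  assumes \<tau>: "singular_simplex (Suc (Suc p)) (top_of_set S) \<tau>"
    and g: "continuous_on S g" "\<And>x. x \<in> S \<Longrightarrow> norm (g x) = 1"
  shows "turns (\<lambda>u. g (singular_face (Suc (Suc p)) 0 \<tau> (first_edge u)))
     - turns (\<lambda>u. g (singular_face (Suc (Suc p)) 1 \<tau> (first_edge u)))
     + turns (\<lambda>u. g (\<tau> (first_edge u))) = 0"
proof -
  define v where "v = (\<lambda>(x, y) (a::nat). if a = 0 then 1 - x - y else if a = 1 then x else if a = 2 then y else (0::real))"
  define T where "T = {(a, b). 0 \<le> a \<and> 0 \<le> b \<and> a + b \<le> (1::real)}"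
  have v: "v q \<in> standard_simplex (Suc (Suc p))" if "q \<in> T" for q
    using that
    by (auto simp: standard_simplex_def v_def T_def sum.atMost_Suc_shift numeral_2_eq_2 simp del: sum.atMost_Suc)
  have \<tau>': "continuous_on (standard_simplex (Suc (Suc p))) \<tau>"
      "\<And>y. y \<in> standard_simplex (Suc (Suc p)) \<Longrightarrow> \<tau> y \<in> S"
    using \<tau> by (auto simp: singular_simplex_top_of_set)
  have "continuous_on T v"
  proof (rule continuous_on_coordinatewise_then_product)
    fix a show "continuous_on T (\<lambda>q. v q a)"
      unfolding v_def case_prod_beta
      by (cases "a = 0"; cases "a = 1"; cases "a = 2") (auto intro!: continuous_intros)
  qed
  then have "continuous_on T (\<lambda>q. g (\<tau> (v q)))"
    using v \<tau>' by (auto intro!: continuous_on_compose2[OF g(1)] continuous_on_compose2[OF \<tau>'(1)])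
  moreover have "norm (g (\<tau> (v q))) = 1" if "q \<in> T" for q
    using v \<tau>' g(2) that by blast
  ultimately have "turns (\<lambda>u. g (\<tau> (v (1 - u, u)))) - turns (\<lambda>u. g (\<tau> (v (0, u))))
     + turns (\<lambda>u. g (\<tau> (v (u, 0)))) = 0"
    unfolding T_def by (rule turns_triangle)
  moreover have "turns (\<lambda>u. g (singular_face (Suc (Suc p)) 0 \<tau> (first_edge u))) = turns (\<lambda>u. g (\<tau> (v (1 - u, u))))"
  proof (rule turns_cong)
    fix u :: real assume "u \<in> {0..1}"
    moreover have "simplical_face 0 (first_edge u) = v (1 - u, u)"
      by (auto simp: v_def first_edge_def simplical_face_def fun_eq_iff)
    ultimately show "g (singular_face (Suc (Suc p)) 0 \<tau> (first_edge u)) = g (\<tau> (v (1 - u, u)))"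
      by (simp add: singular_face_first_edge)
  qed
  moreover have "turns (\<lambda>u. g (singular_face (Suc (Suc p)) 1 \<tau> (first_edge u))) = turns (\<lambda>u. g (\<tau> (v (0, u))))"
  proof (rule turns_cong)
    fix u :: real assume "u \<in> {0..1}"
    moreover have "simplical_face 1 (first_edge u) = v (0, u)"
      by (auto simp: v_def first_edge_def simplical_face_def fun_eq_iff)
    ultimately show "g (singular_face (Suc (Suc p)) 1 \<tau> (first_edge u)) = g (\<tau> (v (0, u)))"
      by (simp add: singular_face_first_edge)
  qed
  moreover have "(\<lambda>u. g (\<tau> (first_edge u))) = (\<lambda>u. g (\<tau> (v (u, 0))))"
    by (auto simp: v_def first_edge_def fun_eq_iff intro!: arg_cong[of _ _ g] arg_cong[of _ _ \<tau>])
  ultimately show ?thesis by simp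
qed

lemma turns_first_edge_face:
  "turns (\<lambda>u. g (singular_face (Suc (Suc p)) (Suc (Suc k)) \<tau> (first_edge u))) = turns (\<lambda>u. g (\<tau> (first_edge u)))"
proof (rule turns_cong)
  fix u :: real assume "u \<in> {0..1}"
  moreover have "simplical_face (Suc (Suc k)) (first_edge u) = first_edge u"
    by (auto simp: first_edge_def simplical_face_def fun_eq_iff)
  ultimately show "g (singular_face (Suc (Suc p)) (Suc (Suc k)) \<tau> (first_edge u)) = g (\<tau> (first_edge u))"
    by (simp add: singular_face_first_edge)
qed

lemma singular_face_0_Suc:
  assumes "j \<le> Suc p"
  shows "singular_face (Suc p) 0 (singular_face (Suc (Suc p)) (Suc j) \<tau>)
       = singular_face (Suc p) j (singular_face (Suc (Suc p)) 0 \<tau>)"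
proof -
  have "simplical_face b y \<in> standard_simplex (Suc p)"
    if "b \<le> Suc p" "y \<in> standard_simplex p" for b and y :: "nat \<Rightarrow> real"
    using that simplical_face_in_standard_simplex[of "Suc p" b y] by simp
  moreover have "simplical_face (Suc j) (simplical_face 0 y) = simplical_face 0 (simplical_face j y)"
    for y :: "nat \<Rightarrow> real"
    by (auto simp: simplical_face_def fun_eq_iff)
  ultimately show ?thesis
    unfolding singular_face_Suc using assms by (intro restrict_eqI) simp
qed

text \<open>In the boundary of \<open>\<tau>\<close>, the faces \<open>0\<close> and \<open>1\<close> have the same back face, namely the face \<open>0\<close> of
  \<open>B = [v\<^sub>1, v\<^sub>2, \<dots>]\<close>, while the faces from \<open>2\<close> on share the first edge of \<open>\<tau>\<close> and have the faces
  of \<open>B\<close> from \<open>1\<close> on as back faces. By induction the latter can be traded for the face \<open>0\<close>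
  of \<open>B\<close>, and then the three edges of the triangle \<open>[v\<^sub>0, v\<^sub>1, v\<^sub>2]\<close> cancel.\<close>

lemma cup_cocycle:
  assumes "singular_simplex (Suc (length gs)) (top_of_set S) \<tau>"
    and "\<And>g. g \<in> set gs \<Longrightarrow> continuous_on S g"
    and "\<And>g x. g \<in> set gs \<Longrightarrow> x \<in> S \<Longrightarrow> norm (g x) = 1"
  shows "(\<Sum>j\<le>Suc (length gs). (-1) ^ j * cup gs (singular_face (Suc (length gs)) j \<tau>)) = (0::'k::comm_ring_1)"
  using assms
proof (induction gs arbitrary: \<tau>)
  case (Cons g gs)
  define p where "p = length gs"
  define B where "B = singular_face (Suc (Suc p)) 0 \<tau>"
  define t where "t j = (of_int (turns (\<lambda>u. g (singular_face (Suc (Suc p)) j \<tau> (first_edge u)))) :: 'k)" for j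
  define t' where "t' = (of_int (turns (\<lambda>u. g (\<tau> (first_edge u)))) :: 'k)"
  define D where "D j = (cup gs (singular_face (Suc p) j B) :: 'k)" for j
  have \<tau>: "singular_simplex (Suc (Suc p)) (top_of_set S) \<tau>"
    using Cons.prems(1) by (simp add: p_def)
  then have "singular_simplex (Suc p) (top_of_set S) B"
    unfolding B_def using singular_simplex_singular_face[OF \<tau>, of 0] by simp
  then have "(\<Sum>j\<le>Suc p. (-1) ^ j * D j) = 0"
    unfolding p_def D_def using Cons.IH Cons.prems(2,3) by simp
  then have IH: "D 0 = (\<Sum>j\<le>p. (-1) ^ j * D (Suc j))"
    by (simp add: sum.atMost_Suc_shift sum_negf del: sum.atMost_Suc)
  have term0: "cup (g # gs) (singular_face (Suc (Suc p)) 0 \<tau>) = t 0 * D 0"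
    by (simp add: t_def D_def B_def p_def)
  have term1: "cup (g # gs) (singular_face (Suc (Suc p)) (Suc 0) \<tau>) = t 1 * D 0"
    using singular_face_0_Suc[of 0 p \<tau>] by (simp add: t_def D_def B_def p_def)
  have term2: "cup (g # gs) (singular_face (Suc (Suc p)) (Suc (Suc k)) \<tau>) = t' * D (Suc k)"
    if "k \<le> p" for k
    using singular_face_0_Suc[of "Suc k" p \<tau>] that
    by (simp add: t'_def D_def B_def p_def turns_first_edge_face)
  have "(\<Sum>j\<le>Suc (Suc p). (-1) ^ j * cup (g # gs) (singular_face (Suc (Suc p)) j \<tau>))
      = t 0 * D 0 - t 1 * D 0 + (\<Sum>j\<le>p. (-1) ^ j * (t' * D (Suc j)))"
    by (simp add: sum.atMost_Suc_shift term0 term1 term2 del: sum.atMost_Suc cup.simps)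
  also have "(\<Sum>j\<le>p. (-1) ^ j * (t' * D (Suc j))) = t' * D 0"
    unfolding IH sum_distrib_left by (intro sum.cong) (auto simp: mult_ac)
  also have "t 0 * D 0 - t 1 * D 0 + t' * D 0 = (t 0 - t 1 + t') * D 0"
    by (simp add: algebra_simps)
  also have "\<dots> = 0"
  proof -
    have "t 0 - t 1 + t' = 0"
      unfolding t_def t'_def of_int_diff[symmetric] of_int_add[symmetric]
      by (subst turns_simplex_triangle[OF \<tau>]) (use Cons.prems(2,3) in auto)
    then show ?thesis by simp
  qed
  finally show ?case by (simp only: p_def length_Cons)
qed simp

lemma pairing_cup_boundary:
  fixes z :: "('a::topological_space, 'k::field) kchain"
  assumes z: "z \<in> kboundaries (length gs) (top_of_set S)"
    and "\<And>g. g \<in> set gs \<Longrightarrow> continuous_on S g"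
    and "\<And>g x. g \<in> set gs \<Longrightarrow> x \<in> S \<Longrightarrow> norm (g x) = 1"
  shows "pairing (cup gs) z = 0"
proof -
  from z obtain d where d: "d \<in> kchains (Suc (length gs)) (top_of_set S)"
    and "z = kboundary (Suc (length gs)) d"
    by (auto simp: kboundaries_def)
  then have "pairing (cup gs) z = pairing (\<lambda>\<sigma>. \<Sum>j\<le>Suc (length gs).
      (-1) ^ j * cup gs (singular_face (Suc (length gs)) j \<sigma>)) d"
    by (simp add: kboundary_Suc pairing_linear_extend pairing_sum del: sum.atMost_Suc)
  also have "\<dots> = pairing (\<lambda>\<sigma>. 0) d"
    using d by (intro pairing_cong cup_cocycle) (auto simp: kchains_def assms)
  finally show ?thesis by (simp add: pairing_def)
qed

text \<open>Multiplying a cycle by a circle multiplies its value by the degree one of that circle. Only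
  the simplex \<open>[v\<^sub>0, w\<^sub>0, \<dots>, w\<^sub>p]\<close> of the prism has a first edge along which \<open>g\<close> turns, and its
  back face is the given simplex, since the homotopy ends at the identity.\<close>

lemma pairing_cup_prism:
  assumes c: "c \<in> kchains (length gs) (top_of_set S)"
    and g: "\<And>t x. t \<in> {0..1} \<Longrightarrow> x \<in> S \<Longrightarrow> g (H t x) = cis (2 * pi * t)"
    and H: "\<And>x. x \<in> S \<Longrightarrow> H 1 x = x"
  shows "pairing (cup (g # gs)) (prism (length gs) H c) = pairing (cup gs) c"
proof -
  define p where "p = length gs"
  have "(\<Sum>j\<le>p. (-1) ^ j * cup (g # gs) (prism_simplex p H j \<sigma>)) = (cup gs \<sigma> :: 'b)"
    if \<sigma>: "singular_simplex p (top_of_set S) \<sigma>" for \<sigma>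
  proof -
    have in_S: "\<sigma> y \<in> S" if "y \<in> standard_simplex p" for y
      using that \<sigma> by (auto simp: singular_simplex_top_of_set)
    have tail: "(\<Sum>a=Suc j..Suc p. first_edge u a) = (if j = 0 then u else 0)" for j u
    proof -
      have "(\<Sum>a=Suc j..Suc p. first_edge u a) = (\<Sum>a=Suc j..Suc p. if a = 1 then u else 0)"
        by (intro sum.cong) (auto simp: first_edge_def)
      then show ?thesis by (simp del: sum.cl_ivl_Suc)
    qed
    have edge: "g (prism_simplex p H j \<sigma> (first_edge u)) = cis (2 * pi * (if j = 0 then u else 0))"
      if "j \<le> p" "u \<in> {0..1}" for j u
    proof -
      have "\<sigma> (degeneracy j (first_edge u)) \<in> S"
        using that by (intro in_S degeneracy_in_standard_simplex first_edge_in_standard_simplex)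
      then show ?thesis
        using that g unfolding prism_simplex_def
        by (simp add: first_edge_in_standard_simplex tail del: sum.cl_ivl_Suc)
    qed
    have "turns (\<lambda>u. g (prism_simplex p H j \<sigma> (first_edge u))) = 0" if "j \<le> p" "j \<noteq> 0" for j
      using edge[OF that(1)] that(2) by (intro turns_const) simp
    then have "(\<Sum>j\<le>p. (-1) ^ j * cup (g # gs) (prism_simplex p H j \<sigma>))
       = (\<Sum>j\<le>p. if j = 0 then cup (g # gs) (prism_simplex p H j \<sigma>) else (0::'b))"
      by (intro sum.cong) auto
    also have "\<dots> = cup (g # gs) (prism_simplex p H 0 \<sigma>)" by simp
    also have "\<dots> = cup gs (singular_face (Suc p) 0 (prism_simplex p H 0 \<sigma>))"
      using turns_loop[of "\<lambda>u. g (prism_simplex p H 0 \<sigma> (first_edge u))"] edge[of 0] by (simp add: p_def)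
    also have "singular_face (Suc p) 0 (prism_simplex p H 0 \<sigma>) = \<sigma>"
      using face_prism_mid(1)[of 0 p H \<sigma>] simplex_map_id_gen[OF \<sigma>, of "H 1"] H
      by (simp add: mid_simplex_ends)
    finally show ?thesis .
  qed
  with c show ?thesis
    by (auto simp: p_def[symmetric] prism_def pairing_linear_extend pairing_sum kchains_def
        simp del: cup.simps intro!: pairing_cong)
qed

section \<open>Characters of right-angled Artin groups\<close>

definition exponent_sum :: "('v \<Rightarrow> int) \<Rightarrow> 'v word \<Rightarrow> int" where
  "exponent_sum wt w = (\<Sum>(v, b)\<leftarrow>w. if b then wt v else - wt v)"

text \<open>An element of the group is a class of words, and any of them may be used to compute the
  character.\<close>

definition raag_char :: "('v \<Rightarrow> int) \<Rightarrow> 'v word set \<Rightarrow> int" where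
  "raag_char wt A = exponent_sum wt (SOME w. w \<in> A)"

lemma raag_char_class [simp]: "raag_char wt (raag_class L w) = exponent_sum wt w"
proof -
  have "exponent_sum wt a = exponent_sum wt b" if "equivclp (raag_step L) a b" for a b
    using that
  proof (induction rule: equivclp_induct)
    case (step y z)
    have "exponent_sum wt a = exponent_sum wt b" if "raag_step L a b" for a b
      using that by cases (auto simp: exponent_sum_def)
    with step show ?case by metis
  qed simp
  moreover have "w \<in> raag_class L w" by (simp add: raag_class_def)
  then have "(SOME w'. w' \<in> raag_class L w) \<in> raag_class L w" by (rule someI)
  ultimately show ?thesis by (simp add: raag_char_def raag_class_def)
qed

lemma raag_char_gen [simp]: "raag_char wt (raag_gen L v) = wt v"
  by (simp add: raag_gen_def exponent_sum_def)

lemma raag_char_epi: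
  assumes v: "v \<in> \<Union>L" "wt v = 1"
  shows "raag_char wt \<in> epi (raag L) integer_group"
proof -
  have "raag_char wt \<in> hom (raag L) integer_group"
  proof (rule homI)
    fix A B assume "A \<in> carrier (raag L)" "B \<in> carrier (raag L)"
    then obtain a b where "A = raag_class L a" "B = raag_class L b"
      by (auto simp: raag_def)
    then show "raag_char wt (A \<otimes>\<^bsub>raag L\<^esub> B) = raag_char wt A \<otimes>\<^bsub>integer_group\<^esub> raag_char wt B"
      by (simp add: raag_mult_class exponent_sum_def)
  qed simp
  moreover have "k \<in> raag_char wt ` carrier (raag L)" for k
  proof -
    define w where "w = replicate (nat \<bar>k\<bar>) (v, 0 \<le> k)"
    have "w \<in> lists (\<Union>L \<times> UNIV)" using v by (auto simp: w_def)
    moreover have "exponent_sum wt w = k"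
      using v by (auto simp: w_def exponent_sum_def sum_list_replicate)
    ultimately show ?thesis
      by (intro image_eqI[of _ _ "raag_class L w"]) (auto simp: raag_def)
  qed
  ultimately show ?thesis by (auto simp: epi_def)
qed

section \<open>The suspension of a simplex and its infinite cyclic cover\<close>

text \<open>The suspension of the simplex on the vertices \<open>2, \<dots>, n + 2\<close>, with suspension points \<open>0\<close>
  and \<open>1\<close>.\<close>

definition suspended_simplex :: "nat \<Rightarrow> nat set set" where
  "suspended_simplex n = {\<sigma>. \<sigma> \<subseteq> {..<n + 3} \<and> \<not> {0, 1} \<subseteq> \<sigma>}"

definition weight :: "nat \<Rightarrow> nat \<Rightarrow> int" where
  "weight m v = (if v < 2 then 1 else if v = 2 then int m else 0)"

text \<open>The infinite cyclic cover of the toric complex in coordinates; the coordinates \<open>0\<close> and \<open>1\<close>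
  form a wedge of circles, as at most one of them differs from the base point.\<close>

definition cyclic_cover :: "nat \<Rightarrow> nat \<Rightarrow> ((nat \<Rightarrow> complex) \<times> real) set" where
  "cyclic_cover m n = {(x, s). (\<forall>v. norm (x v) = 1) \<and> (\<forall>v\<ge>n + 3. x v = 1) \<and> (x 0 = 1 \<or> x 1 = 1) \<and>
     x 0 * x 1 * x 2 ^ m = cis (2 * pi * s)}"

lemma finite_simplicial_complex_suspended_simplex: "finite_simplicial_complex (suspended_simplex n)"
proof -
  have "suspended_simplex n \<subseteq> Pow {..<n + 3}" by (auto simp: suspended_simplex_def)
  then have "finite (suspended_simplex n)" by (rule finite_subset) simp
  then show ?thesis
    unfolding finite_simplicial_complex_def
    by (auto simp: suspended_simplex_def intro: finite_subset[of _ "{..<n + 3}"])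
qed

lemma Union_suspended_simplex: "\<Union>(suspended_simplex n) = {..<n + 3}"
proof -
  have "{v} \<in> suspended_simplex n" if "v < n + 3" for v
    using that by (auto simp: suspended_simplex_def)
  then have "{..<n + 3} \<subseteq> \<Union>(suspended_simplex n)" by blast
  moreover have "\<Union>(suspended_simplex n) \<subseteq> {..<n + 3}" by (auto simp: suspended_simplex_def)
  ultimately show ?thesis by blast
qed

lemma toric_cover_suspended_simplex: "toric_cover (suspended_simplex n) (raag_char (weight m)) = cyclic_cover m n"
proof -
  have tc: "x \<in> toric_complex (suspended_simplex n) \<longleftrightarrow>
      (\<forall>v. norm (x v) = 1) \<and> (\<forall>v\<ge>n + 3. x v = 1) \<and> (x 0 = 1 \<or> x 1 = 1)" (is "_ \<longleftrightarrow> ?R") for x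
  proof
    assume "x \<in> toric_complex (suspended_simplex n)"
    then obtain \<sigma> where \<sigma>: "\<sigma> \<in> suspended_simplex n"
      and "x \<in> {x. (\<forall>v. x v \<in> sphere 0 1) \<and> (\<forall>v. v \<notin> \<sigma> \<longrightarrow> x v = 1)}"
      unfolding toric_complex_def by (rule UN_E)
    then have x: "norm (x v) = 1" "v \<notin> \<sigma> \<Longrightarrow> x v = 1" for v by simp_all
    have "v \<notin> \<sigma>" if "v \<ge> n + 3" for v
      using that \<sigma> by (auto simp: suspended_simplex_def)
    moreover have "0 \<notin> \<sigma> \<or> 1 \<notin> \<sigma>"
      using \<sigma> by (simp add: suspended_simplex_def)
    ultimately show ?R using x by blast
  next
    assume R: ?R
    define \<sigma> where "\<sigma> = {v. x v \<noteq> 1}"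
    have "v < n + 3" if "v \<in> \<sigma>" for v
    proof (rule ccontr)
      assume "\<not> v < n + 3"
      then have "x v = 1" using R by simp
      with that show False by (simp add: \<sigma>_def)
    qed
    moreover have "\<not> {0, 1} \<subseteq> \<sigma>"
      using R by (simp add: \<sigma>_def)
    ultimately have "\<sigma> \<in> suspended_simplex n"
      by (auto simp: suspended_simplex_def)
    then show "x \<in> toric_complex (suspended_simplex n)"
      unfolding toric_complex_def by (rule UN_I) (use R in \<open>simp add: \<sigma>_def\<close>)
  qed
  have char: "toric_char (suspended_simplex n) (raag_char (weight m)) x = x 0 * x 1 * x 2 ^ m" for x
  proof -
    have "toric_char (suspended_simplex n) (raag_char (weight m)) x = (\<Prod>v<n + 3. x v powi weight m v)"
      by (simp add: toric_char_def Union_suspended_simplex)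
    also have "\<dots> = (\<Prod>v\<in>{0, 1, 2}. x v powi weight m v)"
      by (intro prod.mono_neutral_right) (auto simp: weight_def)
    finally show ?thesis by (simp add: weight_def mult.assoc)
  qed
  show ?thesis
    unfolding toric_cover_def cyclic_cover_def tc char by simp
qed

lemma cyclic_cover_nonzero:
  assumes "(x, s) \<in> cyclic_cover m n"
  shows "x v \<noteq> 0"
proof -
  have "norm (x v) = 1" using assms by (auto simp: cyclic_cover_def)
  then show ?thesis by auto
qed

lemma deck_in_cyclic_cover: "p \<in> cyclic_cover m n \<Longrightarrow> deck k p \<in> cyclic_cover m n"
proof -
  have "cis (2 * pi * (s + of_int k)) = cis (2 * pi * s)" for s
    by (simp add: cis_2pi_eq_iff)
  then show "p \<in> cyclic_cover m n \<Longrightarrow> deck k p \<in> cyclic_cover m n"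
    by (auto simp: cyclic_cover_def deck_def)
qed

lemma continuous_map_deck: "continuous_map (top_of_set (cyclic_cover m n)) (top_of_set (cyclic_cover m n)) (deck k)"
proof -
  have "continuous_on (cyclic_cover m n) (deck k)"
    unfolding deck_def case_prod_beta by (intro continuous_intros)
  then show ?thesis using deck_in_cyclic_cover by (auto simp: continuous_map_in_subtopology)
qed

text \<open>A full rotation of a coordinate of weight zero is a closed path of maps of the cover; its
  prism operator multiplies cycles by a circle.\<close>

definition rotate_coord :: "nat \<Rightarrow> real \<Rightarrow> (nat \<Rightarrow> complex) \<times> real \<Rightarrow> (nat \<Rightarrow> complex) \<times> real" where
  "rotate_coord a t = (\<lambda>(x, s). (x(a := x a * cis (2 * pi * t)), s))"

text \<open>Rotating the coordinate of the cone vertex \<open>2\<close>, which has weight \<open>m\<close>, raises the height by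
  \<open>m\<close> in a full turn, so this flow connects the identity to the \<open>m\<close>-th power of the
  generating deck transformation.\<close>

definition cone_flow :: "nat \<Rightarrow> real \<Rightarrow> (nat \<Rightarrow> complex) \<times> real \<Rightarrow> (nat \<Rightarrow> complex) \<times> real" where
  "cone_flow m t = (\<lambda>(x, s). (x(2 := x 2 * cis (2 * pi * t)), s + m * t))"

lemma continuous_on_rotate_update:
  "continuous_on A (\<lambda>(t, x, s). (x(a := x a * cis (2 * pi * t)) :: nat \<Rightarrow> complex, s + c * t))"
  unfolding case_prod_beta
proof (intro continuous_on_Pair continuous_on_coordinatewise_then_product)
  fix v
  have coord: "continuous_on A (\<lambda>p. fst (snd p) i)" for i :: nat
    by (rule continuous_on_product_then_coordinatewise) (intro continuous_intros)
  show "continuous_on A (\<lambda>p. ((fst (snd p))(a := fst (snd p) a * cis (2 * pi * fst p))) v)"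
    using coord by (cases "v = a") (auto intro!: continuous_intros)
qed (intro continuous_intros)

lemma continuous_on_rotate_coord: "continuous_on A (\<lambda>(t, p). rotate_coord a t p)"
  using continuous_on_rotate_update[of A a 0] by (simp add: rotate_coord_def case_prod_beta)

lemma continuous_on_cone_flow: "continuous_on A (\<lambda>(t, p). cone_flow m t p)"
  using continuous_on_rotate_update[of A 2 "real m"] by (simp add: cone_flow_def case_prod_beta)

lemma rotate_coord_in_cyclic_cover: "p \<in> cyclic_cover m n \<Longrightarrow> rotate_coord (n + 3) t p \<in> cyclic_cover m (Suc n)"
  by (auto simp: cyclic_cover_def rotate_coord_def norm_mult)

lemma cone_flow_in_cyclic_cover: "p \<in> cyclic_cover m n \<Longrightarrow> cone_flow m t p \<in> cyclic_cover m n"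
proof -
  have "cis (2 * pi * (s + m * t)) = cis (2 * pi * s) * cis (2 * pi * t) ^ m" for s
  proof -
    have "2 * pi * (s + m * t) = 2 * pi * s + real m * (2 * pi * t)"
      by (simp add: algebra_simps)
    then show ?thesis by (simp only: Complex.DeMoivre cis_mult)
  qed
  then show "p \<in> cyclic_cover m n \<Longrightarrow> cone_flow m t p \<in> cyclic_cover m n"
    by (auto simp: cyclic_cover_def cone_flow_def norm_mult power_mult_distrib mult_ac)
qed

section \<open>Collapsing the cover to one lifted edge\<close>

text \<open>The complement of the first of the \<open>m\<close> equal arcs into which the roots of unity divide the
  circle, with the end points included.\<close>

definition far_arc :: "nat \<Rightarrow> complex set" where
  "far_arc m = (\<lambda>a. cis (2 * pi * a)) ` {1 / real m..1}"

text \<open>This function is invariant under \<open>cone_flow\<close>, and its \<open>m\<close>-th power is the product of the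
  coordinates \<open>0\<close> and \<open>1\<close>. It is therefore the coordinate that presents the \<open>m\<close>-fold cyclic
  cover of the wedge as two circles glued along the \<open>m\<close>-th roots of unity; the generating deck
  transformation moves it from one arc between roots of unity to the next.\<close>

definition sheet :: "nat \<Rightarrow> (nat \<Rightarrow> complex) \<times> real \<Rightarrow> complex" where
  "sheet m p = cis (2 * pi * (snd p / m)) / fst p 2"

text \<open>On the first arc of the first circle this is the full loop given by the coordinate \<open>0\<close>, and
  the rest of the graph is sent to the base point.\<close>

definition collapse :: "nat \<Rightarrow> (nat \<Rightarrow> complex) \<times> real \<Rightarrow> complex" where
  "collapse m p = (if sheet m p \<in> far_arc m then 1 else fst p 0)"

lemma norm_collapse: "p \<in> cyclic_cover m n \<Longrightarrow> norm (collapse m p) = 1"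
  by (auto simp: collapse_def cyclic_cover_def)

lemma near_far_arc:
  assumes "m \<ge> 1" "0 \<le> a" "a \<le> 1 / real m" "cis (2 * pi * a) \<in> far_arc m"
  shows "a = 0 \<or> a = 1 / real m"
proof -
  from assms obtain b where b: "1 / real m \<le> b" "b \<le> 1" "cis (2 * pi * b) = cis (2 * pi * a)"
    by (auto simp: far_arc_def)
  then obtain k :: int where k: "b - a = of_int k"
    unfolding cis_2pi_eq_iff by (auto elim: Ints_cases)
  have "0 \<le> b - a" "b - a \<le> 1" using assms b by auto
  with k have "k = 0 \<or> k = 1" by auto
  with k b assms show ?thesis by auto
qed

text \<open>The cover is the union of the closed sets over the two arcs. They overlap only where the sheet
  coordinate is an \<open>m\<close>-th root of unity; there the product of the coordinates \<open>0\<close> and \<open>1\<close> is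
  \<open>1\<close>, so both of them are \<open>1\<close> and the two definitions agree.\<close>

lemma continuous_on_collapse:
  assumes m: "m \<ge> 1"
  shows "continuous_on (cyclic_cover m n) (collapse m)"
proof -
  define near where "near = (\<lambda>a. cis (2 * pi * a)) ` {0..1 / real m}"
  have closed: "closed near" "closed (far_arc m)"
    unfolding near_def far_arc_def
    by (intro compact_imp_closed compact_continuous_image continuous_intros; simp)+
  have coord: "continuous_on A (\<lambda>p. fst p i)" for A :: "((nat \<Rightarrow> complex) \<times> real) set" and i
    by (rule continuous_on_product_then_coordinatewise) (intro continuous_intros)
  have sheet: "continuous_on (cyclic_cover m n) (sheet m)"
    unfolding sheet_def using m by (auto intro!: continuous_intros coord dest: cyclic_cover_nonzero)
  have unit: "norm (sheet m p) = 1" if "p \<in> cyclic_cover m n" for p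
  proof -
    have "norm (fst p 2) = 1" using that by (auto simp: cyclic_cover_def)
    then show ?thesis by (simp add: sheet_def norm_divide)
  qed
  have cover_arcs: "z \<in> near \<union> far_arc m" if z: "norm z = 1" for z
  proof -
    define a where "a = (if Arg z \<ge> 0 then Arg z / (2 * pi) else Arg z / (2 * pi) + 1)"
    have "cis (2 * pi * (Arg z / (2 * pi))) = z"
      using rcis_cmod_Arg[of z] z by (simp add: rcis_def)
    then have "cis (2 * pi * a) = z"
      using cis_2pi_eq_iff[of a "Arg z / (2 * pi)"] by (simp add: a_def)
    moreover have "0 \<le> a" "a \<le> 1"
      using Arg_bounded[of z] by (auto simp: a_def field_simps)
    ultimately show ?thesis
      by (cases "a \<le> 1 / real m") (force simp: near_def far_arc_def)+
  qed
  have overlap: "fst p 0 = 1" if p: "p \<in> cyclic_cover m n" "sheet m p \<in> near" "sheet m p \<in> far_arc m" for p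
  proof -
    obtain a where a: "0 \<le> a" "a \<le> 1 / real m" "sheet m p = cis (2 * pi * a)"
      using p(2) by (auto simp: near_def)
    then have "a = 0 \<or> a = 1 / real m" using near_far_arc[OF m] p(3) by simp
    then have "sheet m p ^ m = 1" using a(3) m by (auto simp: Complex.DeMoivre)
    moreover have "sheet m p ^ m = cis (2 * pi * snd p) / fst p 2 ^ m"
      using m by (simp add: sheet_def power_divide Complex.DeMoivre)
    moreover have "cis (2 * pi * snd p) = fst p 0 * fst p 1 * fst p 2 ^ m" and "fst p 0 = 1 \<or> fst p 1 = 1"
      using p(1) by (auto simp: cyclic_cover_def)
    moreover have "fst p 2 \<noteq> 0" using p(1) cyclic_cover_nonzero by (metis prod.collapse)
    ultimately show ?thesis by auto
  qed
  let ?N = "cyclic_cover m n \<inter> sheet m -` near" and ?F = "cyclic_cover m n \<inter> sheet m -` far_arc m"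
  have "continuous_on (?F \<union> ?N) (\<lambda>p. if sheet m p \<in> far_arc m then 1 else fst p 0)"
  proof (rule continuous_on_cases_local)
    have "cyclic_cover m n = ?F \<union> ?N" using cover_arcs unit by blast
    moreover have "closedin (top_of_set (cyclic_cover m n)) ?N" "closedin (top_of_set (cyclic_cover m n)) ?F"
      by (intro continuous_closedin_preimage sheet closed)+
    ultimately show "closedin (top_of_set (?F \<union> ?N)) ?F" "closedin (top_of_set (?F \<union> ?N)) ?N"
      by simp_all
    show "continuous_on ?N (\<lambda>p. fst p 0)" by (rule coord)
  qed (use overlap in auto)
  moreover have "cyclic_cover m n = ?F \<union> ?N" using cover_arcs unit by blast
  ultimately show ?thesis by (simp add: collapse_def[abs_def])
qed

section \<open>A cycle separated from its translates\<close>

text \<open>The lift, starting at height zero, of the loop around the circle of a vertex of weight one.\<close>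

definition edge_simplex :: "nat \<Rightarrow> (nat \<Rightarrow> real) \<Rightarrow> (nat \<Rightarrow> complex) \<times> real" where
  "edge_simplex a = restrict (\<lambda>y. ((\<lambda>_. 1)(a := cis (2 * pi * y 1)), y 1)) (standard_simplex 1)"

lemma edge_simplex_singular:
  assumes "a < 2"
  shows "singular_simplex (Suc 0) (top_of_set (cyclic_cover m n)) (edge_simplex a)"
proof -
  have coord: "continuous_on (standard_simplex 1) (\<lambda>y::nat \<Rightarrow> real. y i)" for i
    by (rule continuous_on_subset[OF continuous_on_product_coordinates]) auto
  have "continuous_on (standard_simplex 1) (\<lambda>y. ((\<lambda>_. 1)(a := cis (2 * pi * y 1)) :: nat \<Rightarrow> complex, y 1))"
  proof (intro continuous_on_Pair continuous_on_coordinatewise_then_product coord)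
    fix v show "continuous_on (standard_simplex 1) (\<lambda>y. ((\<lambda>_. 1)(a := cis (2 * pi * y 1)) :: nat \<Rightarrow> complex) v)"
      using coord[of 1] by (cases "v = a") (auto intro!: continuous_intros)
  qed
  then have "continuous_on (standard_simplex 1) (edge_simplex a)"
    by (simp add: edge_simplex_def)
  moreover have "((\<lambda>_. 1)(a := cis (2 * pi * t)), t) \<in> cyclic_cover m n" for t
    using assms by (auto simp: cyclic_cover_def less_2_cases_iff)
  ultimately show ?thesis
    by (auto simp: singular_simplex_top_of_set edge_simplex_def)
qed

text \<open>Both lifts run from height zero to height one over the base point, so their difference is a
  cycle.\<close>

lemma edge_simplex_face:
  assumes "b \<le> 1"
  shows "singular_face (Suc 0) b (edge_simplex a) = singular_face (Suc 0) b (edge_simplex a')"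
proof -
  have "edge_simplex c (simplical_face b y) = ((\<lambda>_. 1), if b = 0 then 1 else 0)"
    if y: "y \<in> standard_simplex 0" for y c
  proof -
    have "simplical_face b y \<in> standard_simplex 1"
      using assms y simplical_face_in_standard_simplex[of 1 b y] by simp
    moreover have "simplical_face b y 1 = (if b = 0 then 1 else 0)"
    proof (cases "b = 0")
      case False
      with assms have "b = 1" by simp
      then show ?thesis by (simp add: simplical_face_def)
    qed (use y in \<open>simp add: simplical_face_def standard_simplex_0\<close>)
    ultimately show ?thesis by (auto simp: edge_simplex_def fun_eq_iff)
  qed
  then show ?thesis
    unfolding singular_face_Suc by (intro restrict_eqI) simp
qed

text \<open>The coordinates of the map from the cover to the torus of dimension \<open>n + 1\<close>.\<close>

primrec circle_maps :: "nat \<Rightarrow> nat \<Rightarrow> ((nat \<Rightarrow> complex) \<times> real \<Rightarrow> complex) list" where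
  "circle_maps m 0 = [collapse m]"
| "circle_maps m (Suc n) = (\<lambda>p. fst p (n + 3)) # circle_maps m n"

lemma length_circle_maps [simp]: "length (circle_maps m n) = Suc n"
  by (induction n) auto

lemma circle_maps_unit:
  "g \<in> set (circle_maps m k) \<Longrightarrow> p \<in> cyclic_cover m n \<Longrightarrow> norm (g p) = 1"
  by (induction k) (auto simp: norm_collapse cyclic_cover_def)

lemma circle_maps_continuous:
  assumes "m \<ge> 1" "g \<in> set (circle_maps m k)"
  shows "continuous_on (cyclic_cover m n) g"
  using assms(2)
proof (induction k)
  case (Suc k)
  have "continuous_on (cyclic_cover m n) (\<lambda>p. fst p (k + 3))"
    by (rule continuous_on_product_then_coordinatewise) (intro continuous_intros)
  with Suc show ?case by auto
qed (auto intro: continuous_on_collapse[OF assms(1)])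

text \<open>The difference of the two lifted edges is multiplied successively by the circles of the
  vertices \<open>3, \<dots>, n + 2\<close>. The deck transformations commute with these products, so the values
  of the cocycle are already determined on the loop for \<open>n = 0\<close>. There the second edge is
  collapsed, and the translates of the first edge are collapsed unless they lie over the
  first arc.\<close>

lemma detected_cycle:
  assumes m: "m \<ge> 1"
  shows "\<exists>c :: (_, 'k::field) kchain. c \<in> kcycles (Suc n) (top_of_set (cyclic_cover m n)) \<and>
     (\<forall>l<m. pairing (cup (circle_maps m n)) (kchain_map (Suc n) (deck (int l)) c) = (if l = 0 then 1 else 0))"
proof (induction n)
  case 0
  define c :: "(_, 'k) kchain"
    where "c = Poly_Mapping.single (edge_simplex 0) 1 - Poly_Mapping.single (edge_simplex 1) 1"
  have "c \<in> kchains (Suc 0) (top_of_set (cyclic_cover m 0))"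
    unfolding c_def by (intro kchains_diff kchains_single edge_simplex_singular) auto
  moreover have "kboundary (Suc 0) c = 0"
    using edge_simplex_face[of 0 0 1] edge_simplex_face[of 1 0 1]
    by (simp add: c_def kboundary_Suc linear_extend_diff)
  moreover have "pairing (cup (circle_maps m 0)) (kchain_map (Suc 0) (deck (int l)) c) = (if l = 0 then 1 else 0)"
    if l: "l < m" for l
  proof -
    define h where "h a u = collapse m (simplex_map (Suc 0) (deck (int l)) (edge_simplex a) (first_edge u))" for a u
    have h: "h a u = collapse m ((\<lambda>_. 1)(a := cis (2 * pi * u)), u + l)" if "u \<in> {0..1}" for a u
      using first_edge_in_standard_simplex[OF that, of 0]
      by (simp add: h_def simplex_map_def edge_simplex_def deck_def first_edge_def)
    \<comment> \<open>The coordinate \<open>0\<close> is constantly \<open>1\<close> on the second edge, so both cases of \<open>collapse\<close> give \<open>1\<close>.\<close>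
    have "turns (h 1) = 0"
      by (rule turns_const) (simp add: h collapse_def)
    moreover have "turns (h 0) = (if l = 0 then 1 else 0)"
    proof (cases "l = 0")
      case True
      have "collapse m ((\<lambda>_. 1)(0 := cis (2 * pi * u)), u) = cis (2 * pi * u)" if "u \<in> {0..1}" for u
        using near_far_arc[OF m, of "u / m"] that m
        by (auto simp: collapse_def sheet_def divide_right_mono)
      then have "turns (h 0) = 1"
        using h[of _ 0] True by (intro turns_loop) simp
      then show ?thesis using True by simp
    next
      case False
      have "cis (2 * pi * ((u + l) / m)) \<in> far_arc m" if "u \<in> {0..1}" for u :: real
        unfolding far_arc_def using that l False
        by (intro imageI) (auto simp: divide_right_mono)
      then have "turns (h 0) = 0"
        using h[of _ 0] by (intro turns_const) (simp add: collapse_def sheet_def)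
      then show ?thesis using False by simp
    qed
    ultimately show ?thesis
      by (simp add: c_def kchain_map_def linear_extend_diff pairing_diff h_def[abs_def])
  qed
  ultimately show ?case
    by (intro exI[of _ c] conjI allI impI) (simp_all only: kcycles_def mem_Collect_eq simp_thms)
next
  case (Suc n)
  let ?H = "rotate_coord (n + 3)"
  from Suc obtain c :: "(_, 'k) kchain" where c: "c \<in> kchains (Suc n) (top_of_set (cyclic_cover m n))"
      "kboundary (Suc n) c = 0"
    and eval: "\<And>l. l < m \<Longrightarrow> pairing (cup (circle_maps m n)) (kchain_map (Suc n) (deck (int l)) c) = (if l = 0 then 1 else 0)"
    by (auto simp: kcycles_def)
  define c' where "c' = prism (Suc n) ?H c"
  have id: "?H 1 p = p" "?H 0 p = p" for p
    by (auto simp: rotate_coord_def split: prod.split)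
  have "c' \<in> kchains (Suc (Suc n)) (top_of_set (cyclic_cover m (Suc n)))"
    unfolding c'_def
    by (rule prism_in_kchains[OF c(1) continuous_on_rotate_coord rotate_coord_in_cyclic_cover])
  moreover have "kboundary (Suc (Suc n)) c' = 0"
    using kchain_map_id_gen[OF c(1), of "?H 1"] kchain_map_id_gen[OF c(1), of "?H 0"] c(2) id
    by (simp add: c'_def kboundary_prism) (simp add: prism_def)
  moreover have "pairing (cup (circle_maps m (Suc n))) (kchain_map (Suc (Suc n)) (deck (int l)) c')
      = (if l = 0 then 1 else 0)" if "l < m" for l
  proof -
    have "kchain_map (Suc (Suc n)) (deck (int l)) c' = prism (Suc n) ?H (kchain_map (Suc n) (deck (int l)) c)"
      unfolding c'_def
      by (rule kchain_map_prism[OF c(1)]) (auto simp: rotate_coord_def deck_def)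
    moreover have "pairing (cup ((\<lambda>p. fst p (n + 3)) # circle_maps m n))
        (prism (length (circle_maps m n)) ?H (kchain_map (Suc n) (deck (int l)) c))
      = pairing (cup (circle_maps m n)) (kchain_map (Suc n) (deck (int l)) c)"
    proof (rule pairing_cup_prism)
      show "kchain_map (Suc n) (deck (int l)) c \<in> kchains (length (circle_maps m n)) (top_of_set (cyclic_cover m n))"
        using kchain_map_in[OF c(1) continuous_map_deck] by simp
    qed (auto simp: id, auto simp: rotate_coord_def cyclic_cover_def)
    ultimately show ?thesis using eval[OF that] by simp
  qed
  ultimately show ?case
    by (intro exI[of _ c'] conjI allI impI) (simp_all only: kcycles_def mem_Collect_eq simp_thms)
qed

section \<open>Polynomials acting on chains\<close>

text \<open>For \<open>X j = t\<^sup>j c\<close> this is the action of the polynomial \<open>p\<close> on the chain \<open>c\<close>. The translates enter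
  only as a sequence, which makes induction on \<open>p\<close> by shifting the sequence possible.\<close>

definition poly_combine :: "'k poly \<Rightarrow> (nat \<Rightarrow> ('b \<Rightarrow>\<^sub>0 'k)) \<Rightarrow> ('b \<Rightarrow>\<^sub>0 'k::field)" where
  "poly_combine p X = (\<Sum>i\<le>Polynomial.degree p. kscale (poly.coeff p i) (X i))"

lemma poly_combine_upto:
  "Polynomial.degree p \<le> N \<Longrightarrow> poly_combine p X = (\<Sum>i\<le>N. kscale (poly.coeff p i) (X i))"
  unfolding poly_combine_def
  by (intro sum.mono_neutral_left) (auto simp: coeff_eq_0)

lemma kscale_add_left: "kscale (a + b) c = kscale a c + kscale b c"
  by (intro poly_mapping_eqI) (simp add: lookup_add algebra_simps)

lemma poly_combine_add: "poly_combine (p + q) X = poly_combine p X + poly_combine q X"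
proof -
  let ?N = "max (Polynomial.degree p) (Polynomial.degree q)"
  have "Polynomial.degree (p + q) \<le> ?N" by (rule degree_add_le_max)
  then show ?thesis
    by (simp add: poly_combine_upto[of _ ?N] kscale_add_left sum.distrib)
qed

lemma poly_combine_smult: "poly_combine (Polynomial.smult a p) X = kscale a (poly_combine p X)"
  by (simp add: poly_combine_upto[of _ "Polynomial.degree p"] kscale_sum)

lemma poly_combine_pCons: "poly_combine (pCons a p) X = kscale a (X 0) + poly_combine p (\<lambda>i. X (Suc i))"
proof -
  have "poly_combine (pCons a p) X = (\<Sum>i\<le>Suc (Polynomial.degree p). kscale (poly.coeff (pCons a p) i) (X i))"
    by (rule poly_combine_upto) (rule degree_pCons_le)
  then show ?thesis
    by (simp add: sum.atMost_Suc_shift poly_combine_def del: sum.atMost_Suc)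
qed

lemma poly_combine_0 [simp]: "poly_combine 0 X = 0"
  by (simp add: poly_combine_def)

lemma poly_combine_mult:
  "poly_combine (p * q) X = poly_combine p (\<lambda>j. poly_combine q (\<lambda>l. X (j + l)))"
proof (induction p arbitrary: X)
  case (pCons a p)
  then show ?case
    by (simp add: mult_pCons_left poly_combine_add poly_combine_smult poly_combine_pCons)
qed simp

lemma poly_combine_monom_minus_1: "poly_combine (Polynomial.monom 1 m - 1) X = X m - X 0"
proof -
  have "poly_combine (Polynomial.monom 1 m) X = X m"
  proof (induction m arbitrary: X)
    case (Suc m)
    then show ?case by (simp add: monom_Suc poly_combine_pCons)
  qed (simp add: monom_0 poly_combine_pCons)
  moreover have "poly_combine 1 X = X 0"
    by (simp add: one_pCons poly_combine_pCons)
  ultimately show ?thesis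
    using poly_combine_add[of "Polynomial.monom 1 m - 1" 1 X] by simp
qed

lemma lookup_laurent_of_poly: "Poly_Mapping.lookup (laurent_of_poly p) (int j) = poly.coeff p j"
proof -
  have "Poly_Mapping.lookup (laurent_of_poly p) (int j)
     = (\<Sum>i\<le>Polynomial.degree p. if i = j then poly.coeff p i else 0)"
    unfolding laurent_of_poly_def lookup_sum by (intro sum.cong) (auto simp: lookup_single when_def)
  then show ?thesis by (simp add: coeff_eq_0)
qed

lemma keys_laurent_of_poly: "Poly_Mapping.keys (laurent_of_poly p) \<subseteq> int ` {..Polynomial.degree p}"
proof
  fix n assume "n \<in> Poly_Mapping.keys (laurent_of_poly p)"
  then have "(\<Sum>i\<le>Polynomial.degree p. Poly_Mapping.lookup (Poly_Mapping.single (int i) (poly.coeff p i)) n) \<noteq> 0"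
    by (simp add: laurent_of_poly_def lookup_sum in_keys_iff)
  then obtain i where "i \<le> Polynomial.degree p" "Poly_Mapping.lookup (Poly_Mapping.single (int i) (poly.coeff p i)) n \<noteq> 0"
    by (auto elim!: sum.not_neutral_contains_not_neutral)
  then show "n \<in> int ` {..Polynomial.degree p}"
    by (auto simp: lookup_single when_def split: if_splits)
qed

lemma laurent_act_poly:
  "laurent_act p T (laurent_of_poly f) c = poly_combine f (\<lambda>j. kchain_map p (T (int j)) c)"
proof -
  let ?q = "laurent_of_poly f"
  have "laurent_act p T ?q c = (\<Sum>n\<in>Poly_Mapping.keys ?q. kscale (Poly_Mapping.lookup ?q n) (kchain_map p (T n) c))"
    unfolding laurent_act_def kchain_map_def
    by (simp flip: linear_extend_scale_fun)
  also have "\<dots> = (\<Sum>n\<in>int ` {..Polynomial.degree f}. kscale (Poly_Mapping.lookup ?q n) (kchain_map p (T n) c))"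
    by (intro sum.mono_neutral_left keys_laurent_of_poly) (auto simp: in_keys_iff)
  also have "\<dots> = poly_combine f (\<lambda>j. kchain_map p (T (int j)) c)"
    by (simp add: sum.reindex poly_combine_def lookup_laurent_of_poly)
  finally show ?thesis .
qed

lemma poly_combine_kchains: "(\<And>j. X j \<in> kchains p S) \<Longrightarrow> poly_combine f X \<in> kchains p S"
  unfolding poly_combine_def by (intro kchains_sum kchains_scale)

lemma kboundary_poly_combine: "kboundary p (poly_combine f X) = poly_combine f (\<lambda>j. kboundary p (X j))"
  by (simp add: poly_combine_def kboundary_sum kboundary_scale)

lemma kchain_map_poly_combine:
  "kchain_map p g (poly_combine f X) = poly_combine f (\<lambda>j. kchain_map p g (X j))"
  by (simp add: poly_combine_def kchain_map_sum kchain_map_scale)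

lemma kchain_map_kboundaries:
  assumes "b \<in> kboundaries p S" "continuous_map S R g"
  shows "kchain_map p g b \<in> kboundaries p R"
  using assms kchain_map_in[OF _ assms(2)]
  by (auto simp: kboundaries_def kboundary_chain_map[symmetric] intro!: imageI)

section \<open>Torsion in the homology of the cover\<close>

text \<open>The scalar multiple in the homology module is a union over the representatives of a class, so
  all representatives, and not only \<open>z\<close>, have to be multiplied into the boundaries.\<close>

lemma primary_part_nontrivialI:
  fixes z :: "('a, 'k::field) kchain"
  assumes T: "\<And>n. continuous_map S S (T n)"
    and z: "z \<in> kcycles p S" "z \<notin> kboundaries p S"
    and fz: "laurent_act p T (laurent_of_poly f) z \<in> kboundaries p S"
  shows "\<not> primary_part laurent_ring (khomology p S T) (laurent_of_poly f)
           \<subseteq> {\<zero>\<^bsub>khomology p S T :: (int \<Rightarrow>\<^sub>0 'k, _) module\<^esub>}"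
proof -
  let ?M = "khomology p S T :: (int \<Rightarrow>\<^sub>0 'k, _) module" and ?f = "laurent_of_poly f"
  have pow: "?f [^]\<^bsub>laurent_ring\<^esub> (1::nat) = ?f"
    by (simp add: nat_pow_def laurent_ring_def)
  have act: "laurent_act p T ?f a \<in> kboundaries p S" if a: "a \<in> hclass p S z" for a
  proof -
    obtain b where b: "b \<in> kboundaries p S" "a = z + b"
      using a by (auto simp: hclass_def)
    have "laurent_act p T ?f a = laurent_act p T ?f z + laurent_act p T ?f b"
      by (simp add: laurent_act_poly poly_combine_def b kchain_map_add kscale_add sum.distrib)
    moreover have "laurent_act p T ?f b \<in> kboundaries p S"
      unfolding laurent_act_poly poly_combine_def
      by (intro kboundaries_sum kboundaries_scale kchain_map_kboundaries[OF b(1) T])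
    ultimately show ?thesis using kboundaries_add[OF fz] by simp
  qed
  have z_in: "z \<in> hclass p S z"
    unfolding hclass_def using kboundaries_0 by (intro image_eqI[of _ _ 0]) auto
  have zero: "\<zero>\<^bsub>?M\<^esub> = kboundaries p S" by (simp add: khomology_def)
  have "?f \<odot>\<^bsub>?M\<^esub> hclass p S z = (\<Union>a\<in>hclass p S z. hclass p S (laurent_act p T ?f a))"
    by (simp add: khomology_def)
  also have "\<dots> = (\<Union>a\<in>hclass p S z. kboundaries p S)"
    by (intro SUP_cong refl hclass_boundary act)
  also have "\<dots> = kboundaries p S" using z_in by blast
  finally have "(?f [^]\<^bsub>laurent_ring\<^esub> (1::nat)) \<odot>\<^bsub>?M\<^esub> hclass p S z = \<zero>\<^bsub>?M\<^esub>"
    unfolding pow zero .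
  moreover have "hclass p S z \<in> carrier ?M"
    using z(1) by (simp add: khomology_def)
  ultimately have "hclass p S z \<in> primary_part laurent_ring ?M ?f"
    unfolding primary_part_def by blast
  moreover have "hclass p S z \<noteq> \<zero>\<^bsub>?M\<^esub>"
    unfolding zero using z_in z(2) by blast
  ultimately show ?thesis by blast
qed

theorem proposition5p8:
  fixes f :: "'k::field poly" and m i :: nat
  assumes "Factorial_Ring.irreducible f" and "m \<ge> 1"
    and "f dvd Polynomial.monom 1 m - 1" and "i > 0"
  shows "\<exists>(L :: nat set set) chi.
           finite_simplicial_complex L \<and>
           chi \<in> epi (raag L) integer_group \<and>
           \<not> primary_part laurent_ring (toric_homology L chi i) (laurent_of_poly f)
               \<subseteq> {\<zero>\<^bsub>toric_homology L chi i :: (int \<Rightarrow>\<^sub>0 'k, _) module\<^esub>}"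
proof -
  obtain n where i: "i = Suc n" using \<open>i > 0\<close> by (cases i) auto
  obtain q where q: "Polynomial.monom 1 m - 1 = f * q" using assms(3) by (rule dvdE)
  let ?P = "Polynomial.monom 1 m - 1 :: 'k poly"
  let ?S = "top_of_set (cyclic_cover m n)" and ?gs = "circle_maps m n"
  \<comment> \<open>The product of the constant coefficients of \<open>f\<close> and \<open>q\<close> is \<open>- 1\<close>, as \<open>m\<close> is positive.\<close>
  have q0: "poly.coeff q 0 \<noteq> 0"
  proof
    assume "poly.coeff q 0 = 0"
    then have "poly.coeff ?P 0 = 0" by (simp add: q coeff_mult)
    then show False using \<open>m \<ge> 1\<close> by simp
  qed
  have deg_q: "Polynomial.degree q < m"
  proof -
    have "f \<noteq> 0" "q \<noteq> 0" using assms(1) q0 by auto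
    moreover have "\<not> f dvd 1" using assms(1) by (rule irreducible_not_unit)
    ultimately have "0 < Polynomial.degree f" by (simp add: is_unit_iff_degree)
    moreover have "Polynomial.degree f + Polynomial.degree q = Polynomial.degree ?P"
      using \<open>f \<noteq> 0\<close> \<open>q \<noteq> 0\<close> by (simp add: q degree_mult_eq)
    moreover have "Polynomial.degree ?P \<le> m"
      by (intro degree_diff_le degree_monom_le) simp
    ultimately show ?thesis by linarith
  qed
  obtain c :: "(_, 'k) kchain" where c: "c \<in> kchains i ?S" "kboundary i c = 0"
    and eval: "\<And>l. l < m \<Longrightarrow> pairing (cup ?gs) (kchain_map i (deck (int l)) c) = (if l = 0 then 1 else 0)"
    using detected_cycle[OF \<open>m \<ge> 1\<close>, of n] unfolding i kcycles_def by auto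
  define X where "X l = kchain_map i (deck (int l)) c" for l
  \<comment> \<open>The class of \<open>z = q c\<close> is the required torsion class.\<close>
  define z where "z = poly_combine q X"
  have X: "X l \<in> kchains i ?S" for l
    unfolding X_def by (rule kchain_map_in[OF c(1) continuous_map_deck])
  have "kboundary i (X l) = 0" for l
    using c(2) unfolding X_def i kboundary_chain_map by (simp add: kchain_map_def)
  then have z: "z \<in> kcycles i ?S"
    using X by (simp add: z_def kcycles_def poly_combine_kchains kboundary_poly_combine)
      (simp add: poly_combine_def)
  \<comment> \<open>Since \<open>q\<close> has degree less than \<open>m\<close>, only translates of \<open>c\<close> with known value occur.\<close>
  have "pairing (cup ?gs) z = (\<Sum>l\<le>Polynomial.degree q. poly.coeff q l * (if l = 0 then 1 else 0))"
    unfolding z_def poly_combine_def pairing_sum pairing_scale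
    using deg_q by (intro sum.cong) (auto simp: X_def eval)
  also have "\<dots> = (\<Sum>l\<le>Polynomial.degree q. if l = 0 then poly.coeff q l else 0)"
    by (intro sum.cong) auto
  also have "\<dots> = poly.coeff q 0" by simp
  finally have "z \<notin> kboundaries i ?S"
    using pairing_cup_boundary[of z ?gs "cyclic_cover m n"] q0 circle_maps_unit
      circle_maps_continuous[OF \<open>m \<ge> 1\<close>] by (auto simp: i)
  moreover have "laurent_act i deck (laurent_of_poly f) z \<in> kboundaries i ?S"
  proof -
    have "kchain_map i (deck (int j)) (X l) = X (j + l)" for j l
      unfolding X_def kchain_map_compose
      by (rule arg_cong[of _ _ "\<lambda>g. kchain_map i g c"]) (auto simp: deck_def fun_eq_iff)
    then have "laurent_act i deck (laurent_of_poly f) z = X m - X 0"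
      by (simp add: laurent_act_poly z_def kchain_map_poly_combine flip: poly_combine_mult
          q poly_combine_monom_minus_1)
    \<comment> \<open>The remaining term of the prism formula vanishes because \<open>c\<close> is a cycle.\<close>
    also have "\<dots> = kboundary (Suc i) (prism i (cone_flow m) c)"
    proof -
      have "cone_flow m 1 = deck (int m)" "cone_flow m 0 = deck (int 0)"
        by (auto simp: cone_flow_def deck_def fun_eq_iff)
      then show ?thesis
        unfolding kboundary_prism c(2) X_def by (simp add: prism_def)
    qed
    also have "\<dots> \<in> kboundaries i ?S"
      unfolding kboundaries_def
      by (intro imageI prism_in_kchains[OF c(1) continuous_on_cone_flow cone_flow_in_cyclic_cover])
    finally show ?thesis .
  qed
  ultimately have "\<not> primary_part laurent_ring (toric_homology (suspended_simplex n) (raag_char (weight m)) i) (laurent_of_poly f)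
      \<subseteq> {\<zero>\<^bsub>toric_homology (suspended_simplex n) (raag_char (weight m)) i :: (int \<Rightarrow>\<^sub>0 'k, _) module\<^esub>}"
    unfolding toric_homology_def toric_cover_suspended_simplex
    using z by (intro primary_part_nontrivialI continuous_map_deck)
  moreover have "raag_char (weight m) \<in> epi (raag (suspended_simplex n)) integer_group"
    by (rule raag_char_epi[of 0]) (auto simp: Union_suspended_simplex weight_def)
  ultimately show ?thesis
    using finite_simplicial_complex_suspended_simplex by blast
qed

end
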